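(* Let $(M,g)$ be a transverse singular space with tangent radical and singular hypersurface $\Sigma$. Then, locally around each point of $\Sigma$ (and with the sign of the main normal $N$, which enters the definition of $\mathcal H$, suitably chosen), there exists a smooth vector field $R\in\mathfrak{X}(\Sigma)$, uniquely determined up to a sign, which is in the radical distribution and $\mathcal H$-unitary, i.e. $$R(p)\in Rad_p\ \text{ for all }p\in\Sigma\qquad\text{and}\qquad \mathcal H(R,R)=-1 .$$
   Context: $M$ is a connected smooth manifold of dimension $m>2$ with a smooth symmetric $(0,2)$-tensor field $g=\langle\cdot,\cdot\rangle$ which fails to have maximal rank exactly on a nonempty set $\Sigma\subset M$. $(M,g)$ is a transverse singular space if in every local coordinate system $\det(g_{ab})$ has nonzero differential at the points of $\Sigma$. Then $\Sigma$ is a smooth hypersurface (the singular hypersurface), and for $p\in\Sigma$ the radical $Rad_p=\{v\in T_pM: g(v,\cdot)=0\}$ is one-dimensional. The radical is tangent if $Rad_p\subset T_p\Sigma$ for all $p\in\Sigma$. $\mathfrak{X}_\Sigma$ denotes smooth vector fields along $\Sigma$; $\mathfrak{X}(\Sigma)$ those tangent to $\Sigma$. The dual connection $\square:\mathfrak{X}(M)\times\mathfrak{X}(M)\to\mathfrak{X}^*(M)$ is defined by $$2\square_{\mathcal A}\mathcal B(\mathcal C)=\mathcal A\langle\mathcal B,\mathcal C\rangle+\mathcal B\langle\mathcal C,\mathcal A\rangle-\mathcal C\langle\mathcal A,\mathcal B\rangle+\langle[\mathcal A,\mathcal B],\mathcal C\rangle-\langle[\mathcal B,\mathcal C],\mathcal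 A\rangle+\langle[\mathcal C,\mathcal A],\mathcal B\rangle .$$ For a vector field $R'$ along $\Sigma$ in the radical, $II_{R'}(A,B):=\square_AB(R')$ is a well-defined symmetric $C^\infty(\Sigma)$-bilinear map on $\mathfrak{X}_\Sigma$. The main normal $N\in\mathfrak{X}_\Sigma$ is the local smooth vector field along $\Sigma$, determined up to a sign, with $\langle N,T\Sigma\rangle=0$, $II_{R'}(N,N)=0$ for any radical $R'$, and $\langle N,N\rangle=\pm1$. The second fundamental form of $\Sigma$ is the symmetric $(0,2)$-tensor field on $\Sigma$ (determined up to a sign) $\mathcal H(X,Y):=-\square_XN(Y)=\square_XY(N)$, $X,Y\in\mathfrak{X}(\Sigma)$. The sign of $N$ is chosen so that $\mathcal H$ is negative on nonzero radical vectors.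
   Formalization: The statement is made near points of Σ where a main normal N exists, so that H is defined; for arbitrary signature N can fail to exist, e.g. g = z dx² + 2 dy dz on R³, where TΣ is its own orthogonal and g vanishes on it. *)

theory Defs
  imports "HOL-Analysis.Analysis"
begin

section \<open>Smooth maps between Euclidean spaces\<close>

text \<open>Intended for open \<^term>\<open>S\<close>; the derivatives are ambient ones.\<close>

primrec Ck_on :: "nat \<Rightarrow> 'a::euclidean_space set \<Rightarrow> ('a \<Rightarrow> 'b::real_normed_vector) \<Rightarrow> bool" where
  "Ck_on 0 S f \<longleftrightarrow> continuous_on S f"
| "Ck_on (Suc k) S f \<longleftrightarrow>
     (\<forall>x\<in>S. f differentiable (at x)) \<and> (\<forall>v. Ck_on k S (\<lambda>x. frechet_derivative f (at x) v))"

definition smooth_on :: "'a::euclidean_space set \<Rightarrow> ('a \<Rightarrow> 'b::real_normed_vector) \<Rightarrow> bool" where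
  "smooth_on S f \<longleftrightarrow> (\<forall>k. Ck_on k S f)"


section \<open>Smooth manifolds\<close>

text \<open>The manifold is the whole Hausdorff, second countable type \<^typ>\<open>'a\<close>. A chart is a domain
  together with a coordinate map, whose values off the domain are irrelevant. The smooth structure
  is a maximal atlas, so that its members are all the local coordinate systems.\<close>

type_synonym ('a, 'n) chart = "'a set \<times> ('a \<Rightarrow> real^'n)"

definition cdom :: "('a, 'n::finite) chart \<Rightarrow> 'a set" where
  "cdom c = fst c"

definition coord :: "('a, 'n::finite) chart \<Rightarrow> 'a \<Rightarrow> real^'n" where
  "coord c = snd c"

definition point :: "('a, 'n::finite) chart \<Rightarrow> real^'n \<Rightarrow> 'a" where
  "point c = inv_into (cdom c) (coord c)"

definition is_chart :: "('a::topological_space, 'n::finite) chart \<Rightarrow> bool" where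
  "is_chart c \<longleftrightarrow> open (cdom c) \<and> open (coord c ` cdom c) \<and>
     homeomorphism (cdom c) (coord c ` cdom c) (coord c) (point c)"

definition smooth_transition :: "('a, 'n::finite) chart \<Rightarrow> ('a, 'n) chart \<Rightarrow> bool" where
  "smooth_transition c d \<longleftrightarrow> smooth_on (coord c ` (cdom c \<inter> cdom d)) (coord d \<circ> point c)"

definition smooth_structure ::
  "('a::{t2_space,second_countable_topology}, 'n::finite) chart set \<Rightarrow> bool" where
  "smooth_structure A \<longleftrightarrow>
     (\<forall>c\<in>A. is_chart c) \<and> (\<Union>c\<in>A. cdom c) = UNIV \<and>
     (\<forall>c\<in>A. \<forall>d\<in>A. smooth_transition c d) \<and>
     (\<forall>c. is_chart c \<and> (\<forall>d\<in>A. smooth_transition c d \<and> smooth_transition d c) \<longrightarrow> c \<in> A)"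


section \<open>Tangent vectors and vector fields\<close>

text \<open>A tangent vector at \<^term>\<open>p\<close> is represented by its components in one preferred chart around
  \<^term>\<open>p\<close>, so every tangent space is \<^typ>\<open>real^'n\<close>. Components in another chart are obtained with
  the Jacobian of the transition map. The preferred chart need not depend continuously on the base
  point, so smoothness of fields is always tested on the components in a fixed chart.\<close>

definition chart_at :: "('a, 'n::finite) chart set \<Rightarrow> 'a \<Rightarrow> ('a, 'n) chart" where
  "chart_at A p = (SOME c. c \<in> A \<and> p \<in> cdom c)"

definition coord_change ::
  "('a, 'n::finite) chart \<Rightarrow> ('a, 'n) chart \<Rightarrow> 'a \<Rightarrow> real^'n \<Rightarrow> real^'n" where
  "coord_change c d p = frechet_derivative (coord d \<circ> point c) (at (coord c p))"

definition components ::
  "('a, 'n::finite) chart set \<Rightarrow> ('a, 'n) chart \<Rightarrow> 'a \<Rightarrow> real^'n \<Rightarrow> real^'n" where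
  "components A c p v = coord_change (chart_at A p) c p v"

definition coord_vector :: "('a, 'n::finite) chart set \<Rightarrow> ('a, 'n) chart \<Rightarrow> 'a \<Rightarrow> 'n \<Rightarrow> real^'n" where
  "coord_vector A c p a = coord_change c (chart_at A p) p (axis a 1)"

type_synonym ('a, 'n) vfield = "'a \<Rightarrow> real^'n"

definition field_rep ::
  "('a, 'n::finite) chart set \<Rightarrow> ('a, 'n) chart \<Rightarrow> ('a, 'n) vfield \<Rightarrow> real^'n \<Rightarrow> real^'n" where
  "field_rep A c X = (\<lambda>x. components A c (point c x) (X (point c x)))"

definition smooth_field :: "('a, 'n::finite) chart set \<Rightarrow> 'a set \<Rightarrow> ('a, 'n) vfield \<Rightarrow> bool" where
  "smooth_field A U X \<longleftrightarrow> (\<forall>c\<in>A. smooth_on (coord c ` (cdom c \<inter> U)) (field_rep A c X))"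

text \<open>Smoothness along an arbitrary subset: local smooth extensibility.\<close>

definition smooth_field_along ::
  "('a::topological_space, 'n::finite) chart set \<Rightarrow> 'a set \<Rightarrow> ('a, 'n) vfield \<Rightarrow> bool" where
  "smooth_field_along A S X \<longleftrightarrow>
     (\<forall>p\<in>S. \<exists>U X'. open U \<and> p \<in> U \<and> smooth_field A U X' \<and> (\<forall>q\<in>U \<inter> S. X' q = X q))"

text \<open>The derivative of the function \<^term>\<open>f\<close> by the tangent vector \<^term>\<open>v\<close> at \<^term>\<open>p\<close>.\<close>

definition dir_deriv ::
  "('a, 'n::finite) chart set \<Rightarrow> 'a \<Rightarrow> real^'n \<Rightarrow> ('a \<Rightarrow> real) \<Rightarrow> real" where
  "dir_deriv A p v f =
     (let c = chart_at A p in frechet_derivative (f \<circ> point c) (at (coord c p)) v)"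

text \<open>The i-th component of the bracket of X and Y is X(Y i) - Y(X i), where X i and Y i are the
  component functions in the preferred chart.\<close>

definition lie_bracket ::
  "('a, 'n::finite) chart set \<Rightarrow> ('a, 'n) vfield \<Rightarrow> ('a, 'n) vfield \<Rightarrow> ('a, 'n) vfield" where
  "lie_bracket A X Y p =
     (let c = chart_at A p; x = coord c p
      in frechet_derivative (field_rep A c Y) (at x) (X p)
         - frechet_derivative (field_rep A c X) (at x) (Y p))"

text \<open>The tangent space at \<^term>\<open>p\<close> of a submanifold \<^term>\<open>S\<close>: velocities of smooth curves in
  \<^term>\<open>S\<close> through \<^term>\<open>p\<close>.\<close>

definition smooth_curve ::
  "('a::topological_space, 'n::finite) chart set \<Rightarrow> real set \<Rightarrow> (real \<Rightarrow> 'a) \<Rightarrow> bool" where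
  "smooth_curve A I \<gamma> \<longleftrightarrow>
     continuous_on I \<gamma> \<and> (\<forall>c\<in>A. smooth_on {t\<in>I. \<gamma> t \<in> cdom c} (coord c \<circ> \<gamma>))"

definition tangent_to ::
  "('a::topological_space, 'n::finite) chart set \<Rightarrow> 'a set \<Rightarrow> 'a \<Rightarrow> (real^'n) set" where
  "tangent_to A S p =
     {v. \<exists>e>0. \<exists>\<gamma>. smooth_curve A {-e<..<e} \<gamma> \<and> \<gamma> ` {-e<..<e} \<subseteq> S \<and> \<gamma> 0 = p \<and>
           ((coord (chart_at A p) \<circ> \<gamma>) has_vector_derivative v) (at 0)}"


section \<open>Transverse singular spaces\<close>

type_synonym ('a, 'n) tensor2 = "'a \<Rightarrow> real^'n \<Rightarrow> real^'n \<Rightarrow> real"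

definition metric_matrix ::
  "('a, 'n::finite) chart set \<Rightarrow> ('a, 'n) tensor2 \<Rightarrow> ('a, 'n) chart \<Rightarrow> 'a \<Rightarrow> real^'n^'n" where
  "metric_matrix A g c p = (\<chi> a b. g p (coord_vector A c p a) (coord_vector A c p b))"

definition smooth_symmetric_tensor ::
  "('a, 'n::finite) chart set \<Rightarrow> ('a, 'n) tensor2 \<Rightarrow> bool" where
  "smooth_symmetric_tensor A g \<longleftrightarrow>
     (\<forall>p. bilinear (g p)) \<and> (\<forall>p u v. g p u v = g p v u) \<and>
     (\<forall>c\<in>A. \<forall>a b. smooth_on (coord c ` cdom c) (\<lambda>x. metric_matrix A g c (point c x) $ a $ b))"

definition form_rank :: "(real^'n \<Rightarrow> real^'n \<Rightarrow> real) \<Rightarrow> nat" where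
  "form_rank B = rank (\<chi> a b. B (axis a 1) (axis b 1) :: real^'n^'n)"

definition singular_set :: "('a, 'n::finite) tensor2 \<Rightarrow> 'a set" where
  "singular_set g = {p. form_rank (g p) < CARD('n)}"

definition rad :: "('a, 'n::finite) tensor2 \<Rightarrow> 'a \<Rightarrow> (real^'n) set" where
  "rad g p = {v. \<forall>w. g p v w = 0}"

definition transverse_singular_space ::
  "('a::{t2_space,second_countable_topology}, 'n::finite) chart set \<Rightarrow> ('a, 'n) tensor2 \<Rightarrow> bool" where
  "transverse_singular_space A g \<longleftrightarrow>
     smooth_structure A \<and> connected (UNIV :: 'a set) \<and> CARD('n) > 2 \<and>
     smooth_symmetric_tensor A g \<and> singular_set g \<noteq> {} \<and>
     (\<forall>c\<in>A. \<forall>p\<in>singular_set g \<inter> cdom c.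
        frechet_derivative (\<lambda>x. det (metric_matrix A g c (point c x))) (at (coord c p)) \<noteq> (\<lambda>v. 0))"

definition tangent_radical ::
  "('a::topological_space, 'n::finite) chart set \<Rightarrow> ('a, 'n) tensor2 \<Rightarrow> bool" where
  "tangent_radical A g \<longleftrightarrow> (\<forall>p\<in>singular_set g. rad g p \<subseteq> tangent_to A (singular_set g) p)"


section \<open>Dual connection, main normal and second fundamental form\<close>

definition dual_connection ::
  "('a, 'n::finite) chart set \<Rightarrow> ('a, 'n) tensor2 \<Rightarrow>
   ('a, 'n) vfield \<Rightarrow> ('a, 'n) vfield \<Rightarrow> ('a, 'n) vfield \<Rightarrow> 'a \<Rightarrow> real" where
  "dual_connection A g X Y Z p =
     (dir_deriv A p (X p) (\<lambda>q. g q (Y q) (Z q))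
      + dir_deriv A p (Y p) (\<lambda>q. g q (Z q) (X q))
      - dir_deriv A p (Z p) (\<lambda>q. g q (X q) (Y q))
      + g p (lie_bracket A X Y p) (Z p)
      - g p (lie_bracket A Y Z p) (X p)
      + g p (lie_bracket A Z X p) (Y p)) / 2"

text \<open>The dual connection evaluated on fields along the singular hypersurface, by means of arbitrary
  local smooth extensions. The value does not depend on the extensions if \<^term>\<open>Z\<close> is in the
  radical, or if \<^term>\<open>X\<close> is tangent to the hypersurface; it is only used in these two cases.\<close>

definition extends_near ::
  "('a::topological_space, 'n::finite) chart set \<Rightarrow> 'a set \<Rightarrow> 'a set \<Rightarrow>
   ('a, 'n) vfield \<Rightarrow> ('a, 'n) vfield \<Rightarrow> bool" where
  "extends_near A S U X X' \<longleftrightarrow> smooth_field A U X' \<and> (\<forall>q\<in>U \<inter> S. X' q = X q)"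

definition dual_connection_along ::
  "('a::topological_space, 'n::finite) chart set \<Rightarrow> ('a, 'n) tensor2 \<Rightarrow>
   ('a, 'n) vfield \<Rightarrow> ('a, 'n) vfield \<Rightarrow> ('a, 'n) vfield \<Rightarrow> 'a \<Rightarrow> real" where
  "dual_connection_along A g X Y Z p =
     (THE h. \<exists>U X' Y' Z'. open U \<and> p \<in> U \<and>
        extends_near A (singular_set g) U X X' \<and> extends_near A (singular_set g) U Y Y' \<and>
        extends_near A (singular_set g) U Z Z' \<and> h = dual_connection A g X' Y' Z' p)"

text \<open>In the following, \<^term>\<open>V\<close> is an open subset of the manifold, and the fields are local
  fields along the part of the singular hypersurface in \<^term>\<open>V\<close>.\<close>

definition radical_field ::
  "('a::topological_space, 'n::finite) chart set \<Rightarrow> ('a, 'n) tensor2 \<Rightarrow> 'a set \<Rightarrow> ('a, 'n) vfield \<Rightarrow> bool" where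
  "radical_field A g V R \<longleftrightarrow>
     smooth_field_along A (singular_set g \<inter> V) R \<and> (\<forall>q\<in>singular_set g \<inter> V. R q \<in> rad g q)"

definition tangent_field ::
  "('a::topological_space, 'n::finite) chart set \<Rightarrow> ('a, 'n) tensor2 \<Rightarrow> 'a set \<Rightarrow> ('a, 'n) vfield \<Rightarrow> bool" where
  "tangent_field A g V X \<longleftrightarrow>
     smooth_field_along A (singular_set g \<inter> V) X \<and>
     (\<forall>q\<in>singular_set g \<inter> V. X q \<in> tangent_to A (singular_set g) q)"

definition II ::
  "('a::topological_space, 'n::finite) chart set \<Rightarrow> ('a, 'n) tensor2 \<Rightarrow>
   ('a, 'n) vfield \<Rightarrow> ('a, 'n) vfield \<Rightarrow> ('a, 'n) vfield \<Rightarrow> 'a \<Rightarrow> real" where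
  "II A g R X Y p = dual_connection_along A g X Y R p"

definition main_normal ::
  "('a::topological_space, 'n::finite) chart set \<Rightarrow> ('a, 'n) tensor2 \<Rightarrow> 'a set \<Rightarrow> ('a, 'n) vfield \<Rightarrow> bool" where
  "main_normal A g V N \<longleftrightarrow>
     smooth_field_along A (singular_set g \<inter> V) N \<and>
     (\<forall>q\<in>singular_set g \<inter> V.
        (\<forall>v\<in>tangent_to A (singular_set g) q. g q (N q) v = 0) \<and>
        (g q (N q) (N q) = 1 \<or> g q (N q) (N q) = -1)) \<and>
     (\<forall>V' R. open V' \<and> V' \<subseteq> V \<and> radical_field A g V' R \<longrightarrow>
        (\<forall>q\<in>singular_set g \<inter> V'. II A g R N N q = 0))"

definition second_ff ::
  "('a::topological_space, 'n::finite) chart set \<Rightarrow> ('a, 'n) tensor2 \<Rightarrow>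
   ('a, 'n) vfield \<Rightarrow> ('a, 'n) vfield \<Rightarrow> ('a, 'n) vfield \<Rightarrow> 'a \<Rightarrow> real" where
  "second_ff A g N X Y p = - dual_connection_along A g X N Y p"

definition negative_on_radical ::
  "('a::topological_space, 'n::finite) chart set \<Rightarrow> ('a, 'n) tensor2 \<Rightarrow> 'a set \<Rightarrow> ('a, 'n) vfield \<Rightarrow> bool" where
  "negative_on_radical A g V N \<longleftrightarrow>
     (\<forall>V' X. open V' \<and> V' \<subseteq> V \<and> radical_field A g V' X \<longrightarrow>
        (\<forall>q\<in>singular_set g \<inter> V'. X q \<noteq> 0 \<longrightarrow> second_ff A g N X X q < 0))"

definition unitary_radical_field ::
  "('a::topological_space, 'n::finite) chart set \<Rightarrow> ('a, 'n) tensor2 \<Rightarrow> 'a set \<Rightarrow>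
   ('a, 'n) vfield \<Rightarrow> ('a, 'n) vfield \<Rightarrow> bool" where
  "unitary_radical_field A g V N R \<longleftrightarrow>
     tangent_field A g V R \<and> radical_field A g V R \<and>
     (\<forall>q\<in>singular_set g \<inter> V. second_ff A g N R R q = -1)"

end

theory Submission
  imports Defs
begin

text \<open>In a chart with metric matrix \<^term>\<open>G\<close>, some row \<^term>\<open>E\<close> of cofactors, with a
  nonvanishing diagonal entry, spans the radical along the singular hypersurface, and
  \<^term>\<open>G *v E\<close> is \<^term>\<open>det G\<close> times a basis vector. When its last argument is radical, the dual
  connection is the Christoffel symbol of the first kind and depends only on the values of the
  fields at the point; hence the second fundamental form of \<^term>\<open>E\<close> is minus one half of the
  derivative of \<^term>\<open>E \<bullet> (G *v E)\<close> along the main normal, that is, a nonvanishing function times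
  the differential of \<^term>\<open>det G\<close> on the normal. A vector on which this differential vanishes is
  tangent to the hypersurface, so it does not vanish on the normal, and \<^term>\<open>E\<close> can be
  normalized after choosing the sign of the normal. Two normals have the same differential up to
  a sign, so two unitary radical fields agree pointwise up to a sign, and this sign is constant on
  a connected piece of the hypersurface.\<close>

section \<open>Calculus of smooth maps\<close>

text \<open>The main normal leaves the hypersurface, so differentiating
  \<open>g q (E q) (E q)\<close> along it requires a frame \<open>E\<close> on an open set, not only
  along the zero set of the determinant. Cofactors supply one: being polynomials in the entries of
  the metric matrix, they are smooth on the whole chart domain, and they are radical wherever
  \<open>det G\<close> vanishes. A diagonal entry is wanted because
  \<open>E \<bullet> (G *v E)\<close> is \<open>det G\<close> times the \<open>k\<close>-th
  component of \<open>E\<close> itself. If the second fundamental form takes the value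
  \<open>- h\<close> on \<open>E\<close>, then on \<open>f *\<^sub>R E\<close> it takes the value
  \<open>- f\<^sup>2 * h\<close>. A normalizing factor therefore exists only for positive
  \<open>h\<close>, and \<open>h\<close> is odd in the normal: this is where the choice of sign
  enters. Values of the dual connection along the hypersurface are definite descriptions over smooth
  extensions, so none can be computed before independence of the extension is known. For a radical
  last argument it comes from cancellations in the Koszul formula.\<close>

lemma Ck_on_cong:
  assumes "open S" "Ck_on k S f" "\<And>x. x \<in> S \<Longrightarrow> f x = g x"
  shows "Ck_on k S g"
  using assms(2,3)
proof (induction k arbitrary: f g)
  case 0
  then show ?case by (metis Ck_on.simps(1) continuous_on_cong)
next
  case (Suc k)
  have "(g has_derivative frechet_derivative f (at x)) (at x)" if "x \<in> S" for x
    using has_derivative_transform_within_open[of f _ x UNIV S g] Suc.prems that \<open>open S\<close>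
      frechet_derivative_works by fastforce
  then have *: "g differentiable (at x) \<and> frechet_derivative g (at x) = frechet_derivative f (at x)"
    if "x \<in> S" for x
    using that by (metis differentiable_def frechet_derivative_at)
  show ?case
    unfolding Ck_on.simps
  proof (intro conjI ballI allI)
    fix v
    show "Ck_on k S (\<lambda>x. frechet_derivative g (at x) v)"
      by (rule Suc.IH[of "\<lambda>x. frechet_derivative f (at x) v"]) (use Suc.prems * in auto)
  qed (use * in auto)
qed

text \<open>Allows the derivative to be given by an explicit formula in place of
  \<open>frechet_derivative\<close>; the inductions for sums, products and compositions step through
  this rule.\<close>

lemma Ck_on_SucI:
  assumes "open S" "\<And>x. x \<in> S \<Longrightarrow> (f has_derivative f' x) (at x)"
    and "\<And>v. Ck_on k S (\<lambda>x. f' x v)"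
  shows "Ck_on (Suc k) S f"
proof -
  have "frechet_derivative f (at x) = f' x" if "x \<in> S" for x
    using assms(2)[OF that] frechet_derivative_at by metis
  then show ?thesis
    using assms(2) by (auto simp: differentiable_def intro!: Ck_on_cong[OF \<open>open S\<close> assms(3)])
qed

lemma Ck_on_SucD: "Ck_on (Suc k) S f \<Longrightarrow> Ck_on k S f"
proof (induction k arbitrary: f)
  case 0
  then show ?case
    by (simp add: continuous_at_imp_continuous_on differentiable_imp_continuous_within)
next
  case (Suc k)
  then show ?case by (metis Ck_on.simps(2))
qed

lemma Ck_on_subset: "Ck_on k S f \<Longrightarrow> T \<subseteq> S \<Longrightarrow> Ck_on k T f"
  by (induction k arbitrary: f) (auto intro: continuous_on_subset)

lemma Ck_on_imp_continuous_on: "Ck_on k S f \<Longrightarrow> continuous_on S f"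
  by (induction k) (auto dest: Ck_on_SucD simp del: Ck_on.simps(2))

lemma Ck_on_const: "open S \<Longrightarrow> Ck_on k S (\<lambda>x. c)"
  by (induction k arbitrary: c) auto

lemma Ck_on_bounded_linear:
  assumes "open S" "bounded_linear f"
  shows "Ck_on k S f"
proof (cases k)
  case 0
  then show ?thesis using assms by (simp add: linear_continuous_on)
next
  case (Suc m)
  then show ?thesis
    using Ck_on_SucI[OF assms(1), of f "\<lambda>x. f"] bounded_linear_imp_has_derivative[OF assms(2)]
      Ck_on_const[OF assms(1)] by blast
qed

lemma Ck_on_add:
  assumes "open S" "Ck_on k S f" "Ck_on k S g"
  shows "Ck_on k S (\<lambda>x. f x + g x)"
  using assms(2,3)
proof (induction k arbitrary: f g)
  case 0
  then show ?case by (simp add: continuous_on_add)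
next
  case (Suc k)
  show ?case
    by (rule Ck_on_SucI[OF \<open>open S\<close>,
          of _ "\<lambda>x v. frechet_derivative f (at x) v + frechet_derivative g (at x) v"])
      (use Suc in \<open>auto intro!: has_derivative_add simp: frechet_derivative_works\<close>)
qed

lemma Ck_on_sum:
  assumes "open S" "\<And>i. i \<in> I \<Longrightarrow> Ck_on k S (f i)"
  shows "Ck_on k S (\<lambda>x. \<Sum>i\<in>I. f i x)"
  using assms(2)
  by (induction I rule: infinite_finite_induct) (auto intro: Ck_on_add Ck_on_const \<open>open S\<close>)

text \<open>Leibniz: each summand of the derivative has one factor differentiated and the other
  lowered by one order, so the induction must vary \<open>f\<close> and \<open>g\<close>. Products
  and scalar multiples are instances.\<close>

lemma Ck_on_bilinear:
  assumes "bounded_bilinear h" "open S" "Ck_on k S f" "Ck_on k S g"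
  shows "Ck_on k S (\<lambda>x. h (f x) (g x))"
  using assms(3,4)
proof (induction k arbitrary: f g)
  case 0
  then show ?case by (simp add: bounded_bilinear.continuous_on[OF assms(1)])
next
  case (Suc k)
  show ?case
  proof (rule Ck_on_SucI[OF \<open>open S\<close>])
    fix x assume "x \<in> S"
    then show "((\<lambda>x. h (f x) (g x)) has_derivative
        (\<lambda>v. h (f x) (frechet_derivative g (at x) v) + h (frechet_derivative f (at x) v) (g x)))
        (at x)"
      using Suc.prems by (auto intro!: bounded_bilinear.FDERIV[OF assms(1)]
          simp: frechet_derivative_works)
  next
    fix v
    show "Ck_on k S (\<lambda>x. h (f x) (frechet_derivative g (at x) v)
        + h (frechet_derivative f (at x) v) (g x))"
      using Suc by (intro Ck_on_add \<open>open S\<close> Suc.IH) (auto dest: Ck_on_SucD simp del: Ck_on.simps(2), auto)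
  qed
qed

text \<open>The chain rule yields \<open>?g' (f x) (?f' x v)\<close>, whose direction moves with
  \<open>x\<close>, whereas \<open>Ck_on\<close> differentiates in fixed directions only. Expanding
  the direction in \<open>Basis\<close> leaves scalar functions times maps
  \<open>?g' (f x) b\<close> with fixed \<open>b\<close>, which the induction hypothesis
  covers.\<close>

lemma Ck_on_compose:
  fixes f :: "'a::euclidean_space \<Rightarrow> 'b::euclidean_space" and g :: "'b \<Rightarrow> 'c::real_normed_vector"
  assumes "open S" "open T" "f ` S \<subseteq> T" "Ck_on k S f" "Ck_on k T g"
  shows "Ck_on k S (\<lambda>x. g (f x))"
  using assms(4,5)
proof (induction k arbitrary: g)
  case 0
  then show ?case by (metis Ck_on.simps(1) assms(3) continuous_on_compose2)
next
  case (Suc k)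
  let ?f' = "\<lambda>x. frechet_derivative f (at x)" and ?g' = "\<lambda>x. frechet_derivative g (at x)"
  have g': "(g has_derivative ?g' (f x)) (at (f x))" if "x \<in> S" for x
    using that Suc.prems(2) assms(3) frechet_derivative_works by (metis Ck_on.simps(2) image_subset_iff)
  have f': "(f has_derivative ?f' x) (at x)" if "x \<in> S" for x
    using that Suc.prems(1) frechet_derivative_works by (metis Ck_on.simps(2))
  show ?case
  proof (rule Ck_on_SucI[OF \<open>open S\<close>])
    fix x assume x: "x \<in> S"
    have eq: "?g' (f x) w = (\<Sum>b\<in>Basis. (w \<bullet> b) *\<^sub>R ?g' (f x) b)" for w
      using arg_cong[OF euclidean_representation[of w], of "?g' (f x)"]
      by (simp add: linear_sum[OF has_derivative_linear[OF g'[OF x]]]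
          linear_scale[OF has_derivative_linear[OF g'[OF x]]])
    have "(\<lambda>v. \<Sum>b\<in>Basis. (?f' x v \<bullet> b) *\<^sub>R ?g' (f x) b) = ?g' (f x) \<circ> ?f' x"
      by (rule ext, simp only: o_apply, rule eq[symmetric])
    then show "((\<lambda>x. g (f x)) has_derivative
        (\<lambda>v. \<Sum>b\<in>Basis. (?f' x v \<bullet> b) *\<^sub>R ?g' (f x) b)) (at x)"
      using diff_chain_at[OF f'[OF x] g'[OF x]] by (simp only: o_def)
  next
    fix v
    have "Ck_on k S (\<lambda>x. ?f' x v \<bullet> b)" for b
      using Suc.prems(1)
      by (intro Ck_on_bilinear[OF bounded_bilinear_inner \<open>open S\<close>] Ck_on_const \<open>open S\<close>) simp
    moreover have "Ck_on k S (\<lambda>x. ?g' (f x) b)" for b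
      by (rule Suc.IH[OF Ck_on_SucD[OF Suc.prems(1)]]) (use Suc.prems(2) in simp)
    ultimately show "Ck_on k S (\<lambda>x. \<Sum>b\<in>Basis. (?f' x v \<bullet> b) *\<^sub>R ?g' (f x) b)"
      by (intro Ck_on_sum Ck_on_bilinear[OF bounded_bilinear_scaleR] \<open>open S\<close>)
  qed
qed

text \<open>The derivative is a polynomial in \<open>inverse\<close> itself, so order
  \<open>k\<close> of the function gives order \<open>k\<close> of the derivative.\<close>

lemma Ck_on_inverse: "Ck_on k (- {0}) (inverse :: real \<Rightarrow> real)"
proof (induction k)
  case 0
  then show ?case by (auto intro!: continuous_intros)
next
  case (Suc k)
  show ?case
  proof (rule Ck_on_SucI)
    show "(inverse has_derivative (\<lambda>v. (inverse x * inverse x) * (- v))) (at x)"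
      if "x \<in> - {0}" for x :: real
      using that
      by (auto intro!: derivative_eq_intros)
    show "Ck_on k (- {0}) (\<lambda>x. (inverse x * inverse x) * (- v))" for v :: real
      by (intro Ck_on_bilinear[OF bounded_bilinear_mult] Ck_on_const Suc) auto
  qed auto
qed

lemma Ck_on_sqrt: "Ck_on k {0<..} sqrt"
proof (induction k)
  case 0
  then show ?case by (auto intro!: continuous_intros)
next
  case (Suc k)
  show ?case
  proof (rule Ck_on_SucI)
    fix x :: real assume "x \<in> {0<..}"
    then show "(sqrt has_derivative (\<lambda>v. inverse (sqrt x) * (v / 2))) (at x)"
      by (auto intro!: derivative_eq_intros simp: field_simps)
  next
    fix v :: real
    show "Ck_on k {0<..} (\<lambda>x. inverse (sqrt x) * (v / 2))"
      by (intro Ck_on_bilinear[OF bounded_bilinear_mult] Ck_on_const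
          Ck_on_compose[OF _ _ _ Suc Ck_on_inverse]) auto
  qed auto
qed

section \<open>The same calculus at all orders at once\<close>

lemma smooth_on_cong: "open S \<Longrightarrow> smooth_on S f \<Longrightarrow> (\<And>x. x \<in> S \<Longrightarrow> f x = g x) \<Longrightarrow> smooth_on S g"
  unfolding smooth_on_def using Ck_on_cong by blast

lemma smooth_on_subset: "smooth_on S f \<Longrightarrow> T \<subseteq> S \<Longrightarrow> smooth_on T f"
  unfolding smooth_on_def using Ck_on_subset by blast

lemma smooth_on_imp_continuous_on: "smooth_on S f \<Longrightarrow> continuous_on S f"
  unfolding smooth_on_def using Ck_on_imp_continuous_on by blast

lemma smooth_on_has_derivative:
  "smooth_on S f \<Longrightarrow> x \<in> S \<Longrightarrow> (f has_derivative frechet_derivative f (at x)) (at x)"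
  unfolding smooth_on_def frechet_derivative_works[symmetric] using Ck_on.simps(2) by blast

lemma smooth_on_frechet_derivative:
  assumes "smooth_on S f"
  shows "smooth_on S (\<lambda>x. frechet_derivative f (at x) v)"
  unfolding smooth_on_def
proof
  fix k
  have "Ck_on (Suc k) S f"
    using assms unfolding smooth_on_def by (rule spec)
  then show "Ck_on k S (\<lambda>x. frechet_derivative f (at x) v)"
    by simp
qed

lemma smooth_on_const: "open S \<Longrightarrow> smooth_on S (\<lambda>x. c)"
  by (simp add: smooth_on_def Ck_on_const)

lemma smooth_on_bounded_linear: "open S \<Longrightarrow> bounded_linear f \<Longrightarrow> smooth_on S f"
  unfolding smooth_on_def by (blast intro: Ck_on_bounded_linear)

lemma smooth_on_add: "open S \<Longrightarrow> smooth_on S f \<Longrightarrow> smooth_on S g \<Longrightarrow> smooth_on S (\<lambda>x. f x + g x)"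
  unfolding smooth_on_def by (blast intro: Ck_on_add)

lemma smooth_on_sum:
  "open S \<Longrightarrow> (\<And>i. i \<in> I \<Longrightarrow> smooth_on S (f i)) \<Longrightarrow> smooth_on S (\<lambda>x. \<Sum>i\<in>I. f i x)"
  unfolding smooth_on_def by (blast intro: Ck_on_sum)

lemma smooth_on_bilinear:
  "bounded_bilinear h \<Longrightarrow> open S \<Longrightarrow> smooth_on S f \<Longrightarrow> smooth_on S g
    \<Longrightarrow> smooth_on S (\<lambda>x. h (f x) (g x))"
  unfolding smooth_on_def by (blast intro: Ck_on_bilinear)

lemmas smooth_on_mult = smooth_on_bilinear[OF bounded_bilinear_mult]
lemmas smooth_on_scaleR = smooth_on_bilinear[OF bounded_bilinear_scaleR]

lemma smooth_on_compose:
  fixes f :: "'a::euclidean_space \<Rightarrow> 'b::euclidean_space" and g :: "'b \<Rightarrow> 'c::real_normed_vector"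
  shows "open S \<Longrightarrow> open T \<Longrightarrow> f ` S \<subseteq> T \<Longrightarrow> smooth_on S f \<Longrightarrow> smooth_on T g
    \<Longrightarrow> smooth_on S (\<lambda>x. g (f x))"
  unfolding smooth_on_def by (blast intro: Ck_on_compose)

lemma smooth_on_linear_compose:
  fixes f :: "'a::euclidean_space \<Rightarrow> 'b::euclidean_space" and g :: "'b \<Rightarrow> 'c::real_normed_vector"
  assumes "open S" "bounded_linear g" "smooth_on S f"
  shows "smooth_on S (\<lambda>x. g (f x))"
  using smooth_on_compose[OF assms(1) open_UNIV _ assms(3) smooth_on_bounded_linear[OF _ assms(2)]]
  by simp

lemma smooth_on_minus:
  fixes f :: "'a::euclidean_space \<Rightarrow> 'b::euclidean_space"
  shows "open S \<Longrightarrow> smooth_on S f \<Longrightarrow> smooth_on S (\<lambda>x. - f x)"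
  by (rule smooth_on_linear_compose[of _ uminus]) (auto intro: bounded_linear_minus bounded_linear_ident)

lemma smooth_on_inverse:
  fixes f :: "'a::euclidean_space \<Rightarrow> real"
  assumes "open S" "smooth_on S f" "\<And>x. x \<in> S \<Longrightarrow> f x \<noteq> 0"
  shows "smooth_on S (\<lambda>x. inverse (f x))"
proof (rule smooth_on_compose[where g=inverse and T="-{0}"])
  show "smooth_on (- {0}) (inverse :: real \<Rightarrow> real)"
    unfolding smooth_on_def by (blast intro: Ck_on_inverse)
qed (use assms in auto)

lemma smooth_on_sqrt:
  fixes f :: "'a::euclidean_space \<Rightarrow> real"
  assumes "open S" "smooth_on S f" "\<And>x. x \<in> S \<Longrightarrow> f x > 0"
  shows "smooth_on S (\<lambda>x. sqrt (f x))"
proof (rule smooth_on_compose[where g=sqrt and T="{0<..}"])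
  show "smooth_on {0<..} sqrt"
    unfolding smooth_on_def by (blast intro: Ck_on_sqrt)
qed (use assms in auto)

lemma smooth_on_prod:
  fixes f :: "'i \<Rightarrow> 'a::euclidean_space \<Rightarrow> real"
  assumes "open S" "\<And>i. i \<in> I \<Longrightarrow> smooth_on S (f i)"
  shows "smooth_on S (\<lambda>x. \<Prod>i\<in>I. f i x)"
  using assms(2)
  by (induction I rule: infinite_finite_induct) (auto intro: smooth_on_mult smooth_on_const \<open>open S\<close>)

lemma smooth_on_vec_nth:
  fixes f :: "'a::euclidean_space \<Rightarrow> real^'n"
  shows "open S \<Longrightarrow> smooth_on S f \<Longrightarrow> smooth_on S (\<lambda>x. f x $ i)"
  by (rule smooth_on_linear_compose[of _ "\<lambda>y. y $ i"]) (auto intro: bounded_linear_vec_nth)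

lemma smooth_on_vec_lambda:
  fixes f :: "'n::finite \<Rightarrow> 'a::euclidean_space \<Rightarrow> real"
  assumes "open S" "\<And>i. smooth_on S (f i)"
  shows "smooth_on S (\<lambda>x. \<chi> i. f i x)"
proof -
  have "(\<chi> i. f i x) = (\<Sum>i\<in>UNIV. f i x *\<^sub>R axis i 1)" for x
    using basis_expansion[of "\<chi> i. f i x"] by (simp add: scalar_mult_eq_scaleR)
  then show ?thesis
    using assms by (auto intro!: smooth_on_sum smooth_on_scaleR smooth_on_const)
qed

lemma smooth_on_det:
  fixes f :: "'a::euclidean_space \<Rightarrow> real^'n^'n"
  assumes "open S" "\<And>i j. smooth_on S (\<lambda>x. f x $ i $ j)"
  shows "smooth_on S (\<lambda>x. det (f x))"
  unfolding det_def using assms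
  by (intro smooth_on_sum smooth_on_mult smooth_on_prod smooth_on_const) auto

text \<open>Bootstrapping: if \<open>\<gamma>\<close> has order \<open>k\<close>, so has its
  velocity \<open>H (\<gamma> t)\<close>, hence \<open>\<gamma>\<close> has order
  \<open>k + 1\<close>. This makes curves obtained from the inverse function theorem smooth although
  the inverse is only known to be differentiable.\<close>

lemma smooth_on_integral_curve:
  fixes \<gamma> :: "real \<Rightarrow> 'b::euclidean_space"
  assumes "open I" "open T" "\<gamma> ` I \<subseteq> T" "smooth_on T H"
    and "\<And>t. t \<in> I \<Longrightarrow> (\<gamma> has_vector_derivative H (\<gamma> t)) (at t)"
  shows "smooth_on I \<gamma>"
  unfolding smooth_on_def
proof
  fix k show "Ck_on k I \<gamma>"
  proof (induction k)
    case 0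
    then show ?case
      using assms(5) by (metis Ck_on.simps(1) continuous_at_imp_continuous_on has_vector_derivative_continuous)
  next
    case (Suc k)
    show ?case
    proof (rule Ck_on_SucI[OF \<open>open I\<close>])
      show "(\<gamma> has_derivative (\<lambda>v. v *\<^sub>R H (\<gamma> t))) (at t)" if "t \<in> I" for t
        using assms(5)[OF that] by (simp add: has_vector_derivative_def)
      show "Ck_on k I (\<lambda>t. v *\<^sub>R H (\<gamma> t))" for v
        using Ck_on_compose[OF assms(1-3) Suc] assms(4) unfolding smooth_on_def
        by (intro Ck_on_bilinear[OF bounded_bilinear_scaleR] Ck_on_const \<open>open I\<close>) auto
    qed
  qed
qed

section \<open>Zero sets of functions with nonvanishing differential\<close>

text \<open>Replacing the component of \<^term>\<open>y\<close> along a transverse unit vector \<^term>\<open>w\<close> by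
  \<^term>\<open>F y\<close> straightens the zero set of \<^term>\<open>F\<close> to a hyperplane.\<close>

lemma zero_set_straightening:
  fixes F :: "'b::euclidean_space \<Rightarrow> real"
  assumes "open O'" "smooth_on O' F" "x \<in> O'" "F x = 0" "frechet_derivative F (at x) \<noteq> (\<lambda>v. 0)"
  obtains w U V \<Psi>
  where "w \<bullet> w = 1" "open U" "x \<in> U" "U \<subseteq> O'" "open V"
    and "homeomorphism U V (\<lambda>y. y + (F y - w \<bullet> y) *\<^sub>R w) \<Psi>"
    and "\<And>y. y \<in> U \<Longrightarrow> frechet_derivative F (at y) w \<noteq> 0"
    and "\<And>z v. z \<in> V \<Longrightarrow> w \<bullet> v = 0 \<Longrightarrow> ((\<lambda>t. \<Psi> (z + t *\<^sub>R v)) has_vector_derivative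
        v - (frechet_derivative F (at (\<Psi> z)) v / frechet_derivative F (at (\<Psi> z)) w) *\<^sub>R w) (at 0)"
proof -
  let ?D = "\<lambda>y. frechet_derivative F (at y)"
  have lin: "bounded_linear (?D y)" if "y \<in> O'" for y
    using smooth_on_has_derivative[OF assms(2) that] by (rule has_derivative_bounded_linear)
  obtain w0 where w0: "?D x w0 \<noteq> 0" using assms(5) by blast
  have "w0 \<noteq> 0"
    using w0 linear_0[OF bounded_linear.linear[OF lin[OF assms(3)]]] by auto
  \<comment> \<open>Unit length makes the \<open>w\<close>-component of
    \<open>y + (F y - w \<bullet> y) *\<^sub>R w\<close> equal to \<open>F y\<close>.\<close>
  define w where "w = w0 /\<^sub>R norm w0"
  have w: "w \<bullet> w = 1"
    using \<open>w0 \<noteq> 0\<close> by (simp add: w_def dot_square_norm power2_eq_square)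
  have Dw: "?D x w \<noteq> 0"
    using w0 \<open>w0 \<noteq> 0\<close> linear_scale[OF bounded_linear.linear[OF lin[OF assms(3)]]]
    by (simp add: w_def)
  define Q where "Q = {y \<in> O'. ?D y w \<noteq> 0}"
  have cont: "continuous_on O' (\<lambda>y. ?D y v)" for v
    by (intro smooth_on_imp_continuous_on smooth_on_frechet_derivative assms)
  have "Q = O' \<inter> (\<lambda>y. ?D y w) -` (-{0})" by (auto simp: Q_def)
  then have "open Q"
    using continuous_open_preimage[OF cont \<open>open O'\<close>, of "-{0}" w] by (simp add: open_Compl)
  have "Q \<subseteq> O'" "x \<in> Q" using Dw assms(3) by (auto simp: Q_def)
  \<comment> \<open>The inverse function theorem asks for a derivative that is continuous as a
    bounded operator. The \<open>Blinfun\<close> is meaningful on \<open>O'\<close>, where its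
    argument is bounded linear.\<close>
  define f' where "f' = (\<lambda>y. Blinfun (\<lambda>u. u + (?D y u - w \<bullet> u) *\<^sub>R w))"
  have bl: "bounded_linear (\<lambda>u. u + (?D y u - w \<bullet> u) *\<^sub>R w)" if "y \<in> O'" for y
    by (intro bounded_linear_add bounded_linear_ident bounded_linear_sub lin[OF that]
        bounded_linear_inner_right bounded_linear_scaleR_const)
  have f': "blinfun_apply (f' y) = (\<lambda>u. u + (?D y u - w \<bullet> u) *\<^sub>R w)" if "y \<in> O'" for y
    unfolding f'_def by (rule bounded_linear_Blinfun_apply[OF bl[OF that]])
  \<comment> \<open>If \<open>z\<close> is the image of \<open>u\<close>, then
    \<open>w \<bullet> z = ?D y u\<close>, so \<open>?D y z - w \<bullet> z\<close> is
    \<open>?D y u - w \<bullet> u\<close> times \<open>?D y w\<close>; dividing recovers the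
    correction that has to be subtracted from \<open>z\<close>.\<close>
  define inv' where "inv' = (\<lambda>y u. u - ((?D y u - w \<bullet> u) / ?D y w) *\<^sub>R w)"
  have li: "inv' y (blinfun_apply (f' y) u) = u" if "y \<in> Q" for y u
  proof -
    note l = bounded_linear.linear[OF lin, of y]
    have "y \<in> O'" "?D y w \<noteq> 0" using that by (auto simp: Q_def)
    then show ?thesis
      by (simp add: inv'_def f' linear_add[OF l] linear_scale[OF l] inner_add_right w
          algebra_simps divide_simps flip: scaleR_add_left scaleR_diff_left)
  qed
  have "bounded_linear (inv' x)"
    unfolding inv'_def
    by (intro bounded_linear_sub bounded_linear_ident bounded_linear_divide[THEN bounded_linear_compose]
        lin[OF assms(3)] bounded_linear_inner_right bounded_linear_scaleR_const)
  then have inv: "Blinfun (inv' x) o\<^sub>L f' x = id_blinfun"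
    by (intro blinfun_eqI) (simp add: bounded_linear_Blinfun_apply li[OF \<open>x \<in> Q\<close>])
  have der: "((\<lambda>y. y + (F y - w \<bullet> y) *\<^sub>R w) has_derivative blinfun_apply (f' y)) (at y)" if "y \<in> Q" for y
  proof -
    have y: "y \<in> O'" using that \<open>Q \<subseteq> O'\<close> by blast
    show ?thesis
      unfolding f'[OF y]
      by (auto intro!: derivative_eq_intros smooth_on_has_derivative[OF assms(2) y])
  qed
  have contf': "continuous_on Q f'"
  proof (rule continuous_on_blinfun_componentwise)
    fix i :: 'b
    have "continuous_on Q (\<lambda>y. i + (?D y i - w \<bullet> i) *\<^sub>R w)"
      by (intro continuous_intros continuous_on_subset[OF cont \<open>Q \<subseteq> O'\<close>])
    then show "continuous_on Q (\<lambda>y. blinfun_apply (f' y) i)"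
      by (rule continuous_on_eq) (use f' \<open>Q \<subseteq> O'\<close> in auto)
  qed
  obtain U V \<Psi> g' where UV: "open U" "U \<subseteq> Q" "x \<in> U" "open V"
    "homeomorphism U V (\<lambda>y. y + (F y - w \<bullet> y) *\<^sub>R w) \<Psi>"
    and g: "\<And>y. y \<in> V \<Longrightarrow> (\<Psi> has_derivative (g' y)) (at y)"
    and g': "\<And>y. y \<in> V \<Longrightarrow> g' y = inv (blinfun_apply (f'(\<Psi> y)))"
    and bij: "\<And>y. y \<in> V \<Longrightarrow> bij (blinfun_apply (f'(\<Psi> y)))"
    by (rule inverse_function_theorem[OF \<open>open Q\<close> der contf' \<open>x \<in> Q\<close> inv]) (assumption, rule that)
  have "((\<lambda>t. \<Psi> (z + t *\<^sub>R v)) has_vector_derivative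
        v - (?D (\<Psi> z) v / ?D (\<Psi> z) w) *\<^sub>R w) (at 0)" if "z \<in> V" "w \<bullet> v = 0" for z v
  proof -
    have "\<Psi> z \<in> Q"
      using UV(2,5) that(1) by (auto simp: homeomorphism_def)
    then have "inv' (\<Psi> z) v = inv (blinfun_apply (f' (\<Psi> z))) v"
      using li[OF \<open>\<Psi> z \<in> Q\<close>] bij[OF that(1)] by (metis bij_inv_eq_iff)
    then have *: "g' z v = v - (?D (\<Psi> z) v / ?D (\<Psi> z) w) *\<^sub>R w"
      using g'[OF that(1)] that(2) by (simp add: inv'_def)
    have "((\<lambda>t. z + t *\<^sub>R v) has_derivative (\<lambda>t. t *\<^sub>R v)) (at 0)"
      by (auto intro!: derivative_eq_intros)
    moreover have "(\<Psi> has_derivative g' z) (at (z + 0 *\<^sub>R v))"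
      using g[OF that(1)] by simp
    ultimately have "((\<lambda>t. \<Psi> (z + t *\<^sub>R v)) has_derivative (\<lambda>t. g' z (t *\<^sub>R v))) (at 0)"
      by (rule has_derivative_compose)
    then show ?thesis
      using linear_scale[OF has_derivative_linear[OF g[OF that(1)]]] *
      by (simp add: has_vector_derivative_def)
  qed
  moreover have "?D y w \<noteq> 0" if "y \<in> U" for y using that \<open>U \<subseteq> Q\<close> by (auto simp: Q_def)
  ultimately show thesis
    using that[of w U V \<Psi>] UV w \<open>Q \<subseteq> O'\<close> by blast
qed

text \<open>The curve is the image under \<open>\<Psi>\<close> of a line in the hyperplane
  orthogonal to \<open>w\<close>. By the derivative formula for \<open>\<Psi>\<close> it is an
  integral curve of a field that is smooth near \<open>x\<close>, and this gives its
  smoothness.\<close>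

lemma zero_set_curve:
  fixes F :: "'b::euclidean_space \<Rightarrow> real"
  assumes "open O'" "smooth_on O' F" "x \<in> O'" "F x = 0" "frechet_derivative F (at x) \<noteq> (\<lambda>v. 0)"
    and "frechet_derivative F (at x) u = 0"
  obtains e \<gamma> where "e > 0" "smooth_on {-e<..<e} \<gamma>" "\<gamma> ` {-e<..<e} \<subseteq> O'"
    "\<And>t. t \<in> {-e<..<e} \<Longrightarrow> F (\<gamma> t) = 0" "\<gamma> 0 = x" "(\<gamma> has_vector_derivative u) (at 0)"
proof -
  let ?D = "\<lambda>y. frechet_derivative F (at y)"
  obtain w U V \<Psi> where w: "w \<bullet> w = 1" and U: "open U" "x \<in> U" "U \<subseteq> O'" and V: "open V"
    and h: "homeomorphism U V (\<lambda>y. y + (F y - w \<bullet> y) *\<^sub>R w) \<Psi>"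
    and Dw: "\<And>y. y \<in> U \<Longrightarrow> ?D y w \<noteq> 0"
    and der: "\<And>z v. z \<in> V \<Longrightarrow> w \<bullet> v = 0 \<Longrightarrow> ((\<lambda>t. \<Psi> (z + t *\<^sub>R v)) has_vector_derivative
        v - (?D (\<Psi> z) v / ?D (\<Psi> z) w) *\<^sub>R w) (at 0)"
    by (rule zero_set_straightening[OF assms(1-5)]) (rule that)
  define \<Phi> where "\<Phi> = (\<lambda>y. y + (F y - w \<bullet> y) *\<^sub>R w)"
  \<comment> \<open>Projection of \<open>u\<close> to the hyperplane. The lifted line has initial
    velocity \<open>u\<close> again, because the differential of \<open>F\<close> annihilates
    \<open>u\<close>.\<close>
  define v where "v = u - (w \<bullet> u) *\<^sub>R w"
  have wv: "w \<bullet> v = 0" by (simp add: v_def inner_diff_right w)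
  have lin: "linear (?D x)"
    using smooth_on_has_derivative[OF assms(2,3)] by (rule has_derivative_linear)
  define \<gamma> where "\<gamma> = (\<lambda>t. \<Psi> (\<Phi> x + t *\<^sub>R v))"
  have \<Phi>x: "\<Phi> x \<in> V" and \<Psi>x: "\<Psi> (\<Phi> x) = x"
    using h U(2) by (auto simp: homeomorphism_def \<Phi>_def)
  have \<Psi>V: "\<Psi> z \<in> U" "\<Phi> (\<Psi> z) = z" if "z \<in> V" for z
    using h that by (auto simp: homeomorphism_def \<Phi>_def)
  have "open ((\<lambda>t. \<Phi> x + t *\<^sub>R v) -` V)"
    by (intro open_vimage V continuous_intros)
  moreover have "0 \<in> (\<lambda>t. \<Phi> x + t *\<^sub>R v) -` V" using \<Phi>x by simp
  ultimately obtain e where e: "e > 0" "ball 0 e \<subseteq> (\<lambda>t. \<Phi> x + t *\<^sub>R v) -` V"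
    by (meson open_contains_ball)
  have ball: "ball 0 e = {-e<..<e::real}" by (auto simp: dist_real_def)
  have inV: "\<Phi> x + t *\<^sub>R v \<in> V" if "t \<in> {-e<..<e}" for t
    using e(2) that unfolding ball by blast
  have der\<gamma>: "(\<gamma> has_vector_derivative v - (?D (\<gamma> t) v / ?D (\<gamma> t) w) *\<^sub>R w) (at t)"
    if "t \<in> {-e<..<e}" for t
  proof -
    have "((\<lambda>s. s - t) has_vector_derivative 1) (at t)"
      by (auto intro!: derivative_eq_intros)
    moreover have "((\<lambda>s. \<Psi> ((\<Phi> x + t *\<^sub>R v) + s *\<^sub>R v)) has_vector_derivative
        v - (?D (\<gamma> t) v / ?D (\<gamma> t) w) *\<^sub>R w) (at (t - t))"
      using der[OF inV[OF that] wv] by (simp add: \<gamma>_def)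
    ultimately have "((\<lambda>s. \<Psi> ((\<Phi> x + t *\<^sub>R v) + s *\<^sub>R v)) \<circ> (\<lambda>s. s - t) has_vector_derivative
        1 *\<^sub>R (v - (?D (\<gamma> t) v / ?D (\<gamma> t) w) *\<^sub>R w)) (at t)"
      by (rule vector_diff_chain_at)
    moreover have "(\<lambda>s. \<Psi> ((\<Phi> x + t *\<^sub>R v) + s *\<^sub>R v)) \<circ> (\<lambda>s. s - t) = \<gamma>"
      by (auto simp: \<gamma>_def algebra_simps)
    ultimately show ?thesis by simp
  qed
  have smH: "smooth_on U (\<lambda>y. v - (?D y v / ?D y w) *\<^sub>R w)"
  proof -
    have "smooth_on U (\<lambda>y. ?D y a)" for a
      by (intro smooth_on_frechet_derivative smooth_on_subset[OF assms(2) U(3)])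
    then have "smooth_on U (\<lambda>y. v + ((?D y v * inverse (?D y w)) *\<^sub>R (- w)))"
      using Dw by (intro smooth_on_add smooth_on_scaleR smooth_on_mult smooth_on_inverse
          smooth_on_const U(1)) auto
    then show ?thesis by (simp add: divide_inverse)
  qed
  have "?D x v = - (w \<bullet> u) * ?D x w"
    using assms(6) by (simp add: v_def linear_diff[OF lin] linear_scale[OF lin])
  then have "v - (?D (\<gamma> 0) v / ?D (\<gamma> 0) w) *\<^sub>R w = u"
    using Dw[OF U(2)] by (simp add: \<gamma>_def \<Psi>x) (simp add: v_def)
  moreover have "F (\<gamma> t) = 0" if "t \<in> {-e<..<e}" for t
  proof -
    have "w \<bullet> \<Phi> y = F y" for y
      by (simp add: \<Phi>_def inner_add_right w)
    then have "F (\<gamma> t) = w \<bullet> (\<Phi> x + t *\<^sub>R v)"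
      using \<Psi>V(2)[OF inV[OF that]] by (metis \<gamma>_def)
    also have "\<dots> = 0"
      using \<open>\<And>y. w \<bullet> \<Phi> y = F y\<close>[of x] assms(4) wv by (simp add: inner_add_right)
    finally show ?thesis .
  qed
  moreover have im: "\<gamma> ` {-e<..<e} \<subseteq> U"
    using inV \<Psi>V by (auto simp: \<gamma>_def)
  moreover have "smooth_on {-e<..<e} \<gamma>"
    by (rule smooth_on_integral_curve[OF _ U(1) im smH]) (auto intro: der\<gamma>)
  ultimately show thesis
    using that[of e \<gamma>] e(1) U(3) der\<gamma>[of 0] by (auto simp: \<gamma>_def \<Psi>x)
qed

text \<open>Straightened, the zero set near \<open>x\<close> is a ball cut by a hyperplane, which is
  convex. Constancy of signs on the hypersurface rests on this.\<close>

lemma zero_set_locally_connected: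
  fixes F :: "'b::euclidean_space \<Rightarrow> real"
  assumes "open O'" "smooth_on O' F" "x \<in> O'" "F x = 0" "frechet_derivative F (at x) \<noteq> (\<lambda>v. 0)"
  obtains W where "open W" "x \<in> W" "W \<subseteq> O'" "connected {y \<in> W. F y = 0}"
proof -
  obtain w U V \<Psi> where w: "w \<bullet> w = 1" and U: "open U" "x \<in> U" "U \<subseteq> O'" and V: "open V"
    and h: "homeomorphism U V (\<lambda>y. y + (F y - w \<bullet> y) *\<^sub>R w) \<Psi>"
    by (rule zero_set_straightening[OF assms]) (rule that)
  define \<Phi> where "\<Phi> = (\<lambda>y. y + (F y - w \<bullet> y) *\<^sub>R w)"
  have h: "homeomorphism U V \<Phi> \<Psi>" using h by (simp add: \<Phi>_def)
  have "\<Phi> x \<in> V" using h U(2) by (auto simp: homeomorphism_def)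
  then obtain r where r: "r > 0" "ball (\<Phi> x) r \<subseteq> V" using V open_contains_ball by blast
  define W where "W = U \<inter> \<Phi> -` ball (\<Phi> x) r"
  have "open W"
    unfolding W_def
    using homeomorphism_cont1[OF h] U(1) continuous_open_preimage by blast
  moreover have "x \<in> W" "W \<subseteq> O'" using r U by (auto simp: W_def)
  moreover have "connected {y \<in> W. F y = 0}"
  proof -
    have F: "w \<bullet> \<Phi> y = F y" for y
      by (simp add: \<Phi>_def inner_add_right w)
    have "{y \<in> W. F y = 0} = \<Psi> ` (ball (\<Phi> x) r \<inter> {z. w \<bullet> z = 0})"
    proof (intro set_eqI iffI)
      fix y assume "y \<in> {y \<in> W. F y = 0}"
      then show "y \<in> \<Psi> ` (ball (\<Phi> x) r \<inter> {z. w \<bullet> z = 0})"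
        using h by (intro image_eqI[of _ _ "\<Phi> y"]) (auto simp: W_def F homeomorphism_def)
    next
      fix y assume "y \<in> \<Psi> ` (ball (\<Phi> x) r \<inter> {z. w \<bullet> z = 0})"
      then obtain z where z: "z \<in> ball (\<Phi> x) r" "w \<bullet> z = 0" "y = \<Psi> z" by blast
      then have "\<Phi> y = z" "y \<in> U" using h r(2) by (auto simp: homeomorphism_def)
      then show "y \<in> {y \<in> W. F y = 0}"
        using z F[of y] by (auto simp: W_def)
    qed
    moreover have "continuous_on (ball (\<Phi> x) r \<inter> {z. w \<bullet> z = 0}) \<Psi>"
      using homeomorphism_cont2[OF h] r(2) continuous_on_subset by blast
    moreover have "connected (ball (\<Phi> x) r \<inter> {z. w \<bullet> z = 0})"
      by (intro convex_connected convex_Int convex_ball convex_hyperplane)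
    ultimately show ?thesis using connected_continuous_image by metis
  qed
  ultimately show thesis using that by blast
qed

section \<open>Cofactors\<close>

text \<open>Row \<open>k\<close> of the cofactor matrix, that is, column \<open>k\<close> of the
  adjugate. Overwriting a row by a basis vector, instead of deleting a row and a column, makes the
  multilinearity of \<open>det\<close> directly applicable.\<close>

definition cofactor_row :: "'n::finite \<Rightarrow> real^'n^'n \<Rightarrow> real^'n" where
  "cofactor_row k G = (\<chi> i. det (\<chi> a. if a = k then axis i 1 else G $ a))"

lemma det_nonzero_iff_kernel:
  fixes G :: "real^'n^'n"
  shows "det G \<noteq> 0 \<longleftrightarrow> (\<forall>v. G *v v = 0 \<longrightarrow> v = 0)"
  by (metis invertible_det_nz invertible_left_inverse matrix_left_invertible_ker)

text \<open>Component \<open>j\<close> is the Laplace expansion of the determinant in which row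
  \<open>k\<close> has been overwritten by row \<open>j\<close> of \<open>G\<close>. For
  \<open>j = k\<close> this is \<open>det G\<close>; otherwise two rows coincide.\<close>

lemma matrix_mult_cofactor_row:
  fixes G :: "real^'n^'n"
  shows "G *v cofactor_row k G = det G *\<^sub>R axis k 1"
unfolding vec_eq_iff
proof
  fix j
  have "(G *v cofactor_row k G) $ j =
      (\<Sum>i\<in>UNIV. G $ j $ i * det (\<chi> a. if a = k then axis i 1 else G $ a))"
    by (simp add: matrix_vector_mult_def cofactor_row_def)
  also have "\<dots> = (\<Sum>i\<in>UNIV. det (\<chi> a. if a = k then (G $ j $ i) *s axis i 1 else G $ a))"
    by (simp add: det_row_mul)
  also have "\<dots> = det (\<chi> a. if a = k then (\<Sum>i\<in>UNIV. (G $ j $ i) *s axis i 1) else G $ a)"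
    using det_linear_row_sum[OF finite_class.finite_UNIV, of k "\<lambda>a i. (G $ j $ i) *s axis i 1" "\<lambda>a. G $ a"]
    by simp
  also have "\<dots> = det (\<chi> a. if a = k then G $ j else G $ a)"
    by (simp only: basis_expansion)
  also have "\<dots> = (det G *\<^sub>R axis k 1) $ j"
  proof (cases "j = k")
    case True
    then have "(\<chi> a. if a = k then G $ j else G $ a) = G" by (auto simp: vec_eq_iff)
    then show ?thesis using True by simp
  next
    case False
    then have "det (\<chi> a. if a = k then G $ j else G $ a) = 0"
      by (intro det_identical_rows[of j k]) (auto simp: row_def vec_eq_iff)
    then show ?thesis using False by (simp add: axis_def)
  qed
  finally show "(G *v cofactor_row k G) $ j = (det G *\<^sub>R axis k 1) $ j" .
qed

lemma replaced_row_mult: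
  fixes G :: "real^'n^'n"
  shows "((\<chi> a. if a = k then axis i 1 else G $ a) *v v) $ j = (if j = k then v $ i else (G *v v) $ j)"
  by (simp add: matrix_vector_mul_component inner_axis')

text \<open>A nonzero entry \<open>i\<close> says that \<open>G\<close> becomes invertible once row
  \<open>k\<close> is replaced by \<open>axis i 1\<close>. Hence a kernel vector with vanishing
  \<open>i\<close>-th component is zero, and subtracting a multiple of the cofactor row, itself in
  the kernel, reaches that case.\<close>

lemma kernel_cofactor_row:
  fixes G :: "real^'n^'n"
  assumes "det G = 0" "cofactor_row k G \<noteq> 0" "G *v v = 0"
  obtains f where "v = f *\<^sub>R cofactor_row k G"
proof -
  obtain i where i: "cofactor_row k G $ i \<noteq> 0"
    using assms(2) by (metis vec_eq_iff zero_index)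
  let ?M = "\<chi> a. if a = k then axis i 1 else G $ a"
  define v' where "v' = v - (v $ i / cofactor_row k G $ i) *\<^sub>R cofactor_row k G"
  have "G *v v' = 0"
    using matrix_mult_cofactor_row[of G k] assms
    by (simp add: v'_def matrix_vector_mult_diff_distrib matrix_vector_mult_scaleR)
  moreover have "v' $ i = 0" using i by (simp add: v'_def)
  ultimately have "?M *v v' = 0" by (simp add: vec_eq_iff replaced_row_mult)
  moreover have "det ?M \<noteq> 0" using i by (simp add: cofactor_row_def)
  ultimately have "v' = 0" using det_nonzero_iff_kernel by blast
  then show thesis using that v'_def by simp
qed

text \<open>By symmetry the kernel vector \<open>r\<close> is orthogonal to the image of
  \<open>G\<close>. If \<open>r $ i\<close> is nonzero and all components of \<open>G *v v\<close>
  other than the \<open>i\<close>-th vanish, then so does the \<open>i\<close>-th, and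
  \<open>v\<close> is a multiple of \<open>r\<close>; with \<open>v $ i = 0\<close> it is zero. So
  the minor obtained by replacing row \<open>i\<close> is invertible.\<close>

lemma symmetric_cofactor_diagonal:
  fixes G :: "real^'n^'n"
  assumes "transpose G = G" "det G = 0" "cofactor_row k G \<noteq> 0"
  obtains i where "cofactor_row i G $ i \<noteq> 0"
proof -
  define r where "r = cofactor_row k G"
  obtain i where i: "r $ i \<noteq> 0"
    using assms(3) by (metis r_def vec_eq_iff zero_index)
  have r: "G *v r = 0" using matrix_mult_cofactor_row[of G k] assms(2) by (simp add: r_def)
  have "v = 0" if "(\<chi> a. if a = i then axis i 1 else G $ a) *v v = 0" for v
  proof -
    have v: "v $ i = 0" "\<And>j. j \<noteq> i \<Longrightarrow> (G *v v) $ j = 0"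
      using that replaced_row_mult[of i i G v] by (auto simp: vec_eq_iff) metis+
    have "r \<bullet> (G *v v) = (G *v r) \<bullet> v"
      using dot_lmul_matrix[of r G v] assms(1)
      by (metis matrix_transpose_mul transpose_matrix_vector)
    then have "r \<bullet> (G *v v) = 0" by (simp add: r)
    moreover have "r \<bullet> (G *v v) = r $ i * (G *v v) $ i"
      unfolding inner_vec_def using v(2)
      by (subst sum.remove[of _ i]) auto
    ultimately have "(G *v v) $ i = 0" using i by simp
    then have "G *v v = 0" using v(2) unfolding vec_eq_iff zero_index by metis
    then obtain f where "v = f *\<^sub>R r"
      using kernel_cofactor_row[OF assms(2,3)] r_def by metis
    then show ?thesis using v(1) i by simp
  qed
  then have "cofactor_row i G $ i \<noteq> 0"
    by (simp add: cofactor_row_def det_nonzero_iff_kernel)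
  then show thesis using that by blast
qed

text \<open>Differentiate the identity \<^term>\<open>G *v cofactor_row k G = det G *\<^sub>R axis k 1\<close> for every
  \<^term>\<open>k\<close>: if all cofactors vanish, then the image of \<^term>\<open>G\<close> contains the whole space.\<close>

lemma cofactor_row_nonzero_if_det_derivative_nonzero:
  fixes G :: "real^'n \<Rightarrow> real^'n^'n"
  assumes "open S" "x \<in> S" "\<And>i j. smooth_on S (\<lambda>y. G y $ i $ j)" "det (G x) = 0"
    and "frechet_derivative (\<lambda>y. det (G y)) (at x) \<noteq> (\<lambda>v. 0)"
  obtains k where "cofactor_row k (G x) \<noteq> 0"
proof -
  have smc: "smooth_on S (\<lambda>y. cofactor_row k (G y) $ i)" for k i
  proof -
    have "smooth_on S (\<lambda>y. (\<chi> a. if a = k then axis i 1 else G y $ a) $ j $ l)" for j l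
      using assms(3)[of j l] by (cases "j = k") (auto intro: smooth_on_const \<open>open S\<close>)
    then show ?thesis
      unfolding cofactor_row_def by (simp add: smooth_on_det \<open>open S\<close>)
  qed
  have smd: "smooth_on S (\<lambda>y. det (G y))" by (rule smooth_on_det[OF assms(1,3)])
  let ?d = "frechet_derivative (\<lambda>y. det (G y)) (at x)"
  have "\<exists>k. cofactor_row k (G x) \<noteq> 0"
  proof (rule ccontr)
    assume "\<nexists>k. cofactor_row k (G x) \<noteq> 0"
    then have 0: "cofactor_row k (G x) $ i = 0" for k i by simp
    obtain v where v: "?d v \<noteq> 0" using assms(5) by blast
    define z where "z = (\<lambda>k. \<chi> i. frechet_derivative (\<lambda>y. cofactor_row k (G y) $ i) (at x) v)"
    \<comment> \<open>The terms in which \<open>G\<close> is differentiated carry a factor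
      \<open>cofactor_row k (G x) $ i\<close> and drop out.\<close>
    have z: "(G x *v z k) $ j = ?d v * axis k 1 $ j" for j k
    proof -
      have "((\<lambda>y. \<Sum>i\<in>UNIV. G y $ j $ i * cofactor_row k (G y) $ i) has_derivative
          (\<lambda>v. \<Sum>i\<in>UNIV. G x $ j $ i * frechet_derivative (\<lambda>y. cofactor_row k (G y) $ i) (at x) v
            + frechet_derivative (\<lambda>y. G y $ j $ i) (at x) v * cofactor_row k (G x) $ i)) (at x)"
        by (intro has_derivative_sum has_derivative_mult smooth_on_has_derivative[OF _ \<open>x \<in> S\<close>] smc assms(3))
      moreover have "(\<lambda>y. \<Sum>i\<in>UNIV. G y $ j $ i * cofactor_row k (G y) $ i)
          = (\<lambda>y. det (G y) * axis k 1 $ j)"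
        using matrix_mult_cofactor_row[of _ k] by (auto simp: vec_eq_iff matrix_vector_mult_def)
      moreover have "((\<lambda>y. det (G y) * axis k 1 $ j) has_derivative (\<lambda>v. ?d v * axis k 1 $ j)) (at x)"
        by (intro has_derivative_mult_left smooth_on_has_derivative[OF smd \<open>x \<in> S\<close>])
      ultimately have "(\<lambda>v. \<Sum>i\<in>UNIV. G x $ j $ i * frechet_derivative (\<lambda>y. cofactor_row k (G y) $ i) (at x) v
            + frechet_derivative (\<lambda>y. G y $ j $ i) (at x) v * cofactor_row k (G x) $ i)
          = (\<lambda>v. ?d v * axis k 1 $ j)"
        using has_derivative_unique by (simp only:)
      from fun_cong[OF this, of v] show ?thesis
        by (simp add: 0 z_def matrix_vector_mult_def)
    qed
    have "\<exists>u. G x *v u = y" for y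
    proof
      have "G x *v (\<Sum>k\<in>UNIV. (y $ k / ?d v) *\<^sub>R z k) = (\<Sum>k\<in>UNIV. (y $ k / ?d v) *\<^sub>R (G x *v z k))"
        by (simp add: linear_sum[OF matrix_vector_mul_linear] matrix_vector_mult_scaleR)
      also have "\<dots> = (\<Sum>k\<in>UNIV. (y $ k) *s axis k 1)"
        using v z by (intro sum.cong) (auto simp: vec_eq_iff)
      also have "\<dots> = y" by (rule basis_expansion)
      finally show "G x *v (\<Sum>k\<in>UNIV. (y $ k / ?d v) *\<^sub>R z k) = y" .
    qed
    then have "det (G x) \<noteq> 0"
      using matrix_right_invertible_surjective[of "G x"]
      by (simp add: invertible_det_nz[symmetric] invertible_right_inverse surj_def) metis
    then show False using assms(4) by simp
  qed
  then show thesis using that by blast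
qed

section \<open>Charts and vector fields\<close>

locale smooth_manifold =
  fixes A :: "('a::{t2_space,second_countable_topology}, 'n::finite) chart set"
  assumes smooth_structure: "smooth_structure A"
begin

lemma chart_cover: "\<exists>c\<in>A. q \<in> cdom c"
  using smooth_structure unfolding smooth_structure_def by blast

lemma chart_at: "chart_at A q \<in> A" "q \<in> cdom (chart_at A q)"
  using someI_ex[of "\<lambda>c. c \<in> A \<and> q \<in> cdom c"] chart_cover[of q] unfolding chart_at_def by auto

context
  fixes c assumes c: "c \<in> A"
begin

lemma is_chart: "is_chart c"
  using smooth_structure c unfolding smooth_structure_def by blast

lemma open_cdom: "open (cdom c)"
  using is_chart by (simp add: is_chart_def)

lemma homeomorphism_coord: "homeomorphism (cdom c) (coord c ` cdom c) (coord c) (point c)"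
  using is_chart by (simp add: is_chart_def)

lemma point_coord: "q \<in> cdom c \<Longrightarrow> point c (coord c q) = q"
  using homeomorphism_coord by (simp add: homeomorphism_def)

lemma coord_point: "x \<in> coord c ` cdom c \<Longrightarrow> coord c (point c x) = x"
  using point_coord by auto

lemma point_in_cdom: "x \<in> coord c ` cdom c \<Longrightarrow> point c x \<in> cdom c"
  using point_coord by auto

lemma open_coord_image:
  assumes "open U"
  shows "open (coord c ` (cdom c \<inter> U))"
proof -
  have "openin (top_of_set (coord c ` cdom c)) (coord c ` (cdom c \<inter> U))"
    using homeomorphism_imp_open_map[OF homeomorphism_coord] assms open_cdom
    by (simp add: open_Int openin_open_Int)
  then show ?thesis using is_chart openin_open_trans by (auto simp: is_chart_def)
qed

lemma open_point_image:
  assumes "open T" "T \<subseteq> coord c ` cdom c"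
  shows "open (point c ` T)"
proof -
  have "openin (top_of_set (cdom c)) (point c ` T)"
    using homeomorphism_imp_open_map[OF homeomorphism_symD[OF homeomorphism_coord]] assms
    by (metis open_subset)
  then show ?thesis using open_cdom openin_open_trans by blast
qed

end

lemma smooth_on_transition:
  assumes "c \<in> A" "d \<in> A"
  shows "smooth_on (coord c ` (cdom c \<inter> cdom d)) (coord d \<circ> point c)"
  using smooth_structure assms unfolding smooth_structure_def smooth_transition_def by blast

lemma has_derivative_transition:
  assumes "c \<in> A" "d \<in> A" "q \<in> cdom c" "q \<in> cdom d"
  shows "(coord d \<circ> point c has_derivative coord_change c d q) (at (coord c q))"
  unfolding coord_change_def
  by (rule smooth_on_has_derivative[OF smooth_on_transition]) (use assms in auto)

lemma linear_coord_change:
  assumes "c \<in> A" "d \<in> A" "q \<in> cdom c" "q \<in> cdom d"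
  shows "linear (coord_change c d q)"
  by (rule has_derivative_linear[OF has_derivative_transition[OF assms]])

lemma coord_change_self:
  assumes "c \<in> A" "q \<in> cdom c"
  shows "coord_change c c q v = v"
proof -
  have "((\<lambda>x. x) has_derivative (\<lambda>x. x)) (at (coord c q))" by (rule has_derivative_ident)
  then have "(coord c \<circ> point c has_derivative (\<lambda>x. x)) (at (coord c q))"
    by (rule has_derivative_transform_within_open[where s="coord c ` cdom c"])
      (use assms open_coord_image[OF assms(1) open_UNIV] coord_point in auto)
  then show ?thesis
    using has_derivative_transition[OF assms(1,1) assms(2,2)] has_derivative_unique by metis
qed

lemma coord_change_compose:
  assumes "c \<in> A" "d \<in> A" "e \<in> A" "q \<in> cdom c" "q \<in> cdom d" "q \<in> cdom e"
  shows "coord_change d e q (coord_change c d q v) = coord_change c e q v"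
proof -
  have "coord d q = (coord d \<circ> point c) (coord c q)"
    by (simp add: assms point_coord)
  then have "((coord e \<circ> point d) \<circ> (coord d \<circ> point c) has_derivative
      coord_change d e q \<circ> coord_change c d q) (at (coord c q))"
    using has_derivative_transition[of d e q] has_derivative_transition[of c d q] assms
    by (intro diff_chain_at) auto
  then have "(coord e \<circ> point c has_derivative
      coord_change d e q \<circ> coord_change c d q) (at (coord c q))"
    by (rule has_derivative_transform_within_open[where s="coord c ` (cdom c \<inter> cdom d)"])
      (use assms in \<open>auto intro!: open_coord_image simp: point_coord open_cdom\<close>)
  then have "coord_change d e q \<circ> coord_change c d q = coord_change c e q"
    using has_derivative_transition[of c e q] assms has_derivative_unique by blast
  then show ?thesis by (metis o_apply)
qed

lemma smooth_on_coord_change: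
  assumes "c \<in> A" "d \<in> A"
  shows "smooth_on (coord c ` (cdom c \<inter> cdom d)) (\<lambda>x. coord_change c d (point c x) v)"
proof (rule smooth_on_cong)
  show "smooth_on (coord c ` (cdom c \<inter> cdom d)) (\<lambda>x. frechet_derivative (coord d \<circ> point c) (at x) v)"
    by (intro smooth_on_frechet_derivative smooth_on_transition assms)
qed (use assms in \<open>auto intro!: open_coord_image simp: open_cdom point_coord coord_change_def\<close>)

lemma linear_components: "c \<in> A \<Longrightarrow> q \<in> cdom c \<Longrightarrow> linear (components A c q)"
  unfolding components_def using linear_coord_change chart_at by (metis (no_types, lifting) ext)

lemma components_chart_at: "components A (chart_at A q) q v = v"
  unfolding components_def by (rule coord_change_self[OF chart_at])

lemma coord_change_components:
  assumes "c \<in> A" "d \<in> A" "q \<in> cdom c" "q \<in> cdom d"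
  shows "coord_change c d q (components A c q v) = components A d q v"
  unfolding components_def by (rule coord_change_compose) (use assms chart_at in auto)

lemma from_components:
  assumes "c \<in> A" "q \<in> cdom c"
  shows "coord_change c (chart_at A q) q (components A c q v) = v"
  using coord_change_components[OF assms(1) chart_at(1) assms(2) chart_at(2)]
  by (simp add: components_chart_at)

lemma components_coord_change:
  assumes "c \<in> A" "q \<in> cdom c"
  shows "components A c q (coord_change c (chart_at A q) q u) = u"
  unfolding components_def
  using coord_change_compose[of c "chart_at A q" c q] assms chart_at coord_change_self by metis

text \<open>The Jacobian is smooth on fixed vectors only; since \<open>e x\<close> varies, it is
  expanded in the standard basis.\<close>

lemma smooth_on_apply_coord_change:
  assumes "c \<in> A" "d \<in> A" "open S" "S \<subseteq> coord c ` (cdom c \<inter> cdom d)" "smooth_on S e"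
  shows "smooth_on S (\<lambda>x. coord_change c d (point c x) (e x))"
proof (rule smooth_on_cong[OF assms(3)])
  show "smooth_on S (\<lambda>x. \<Sum>i\<in>UNIV. e x $ i *\<^sub>R coord_change c d (point c x) (axis i 1))"
    using smooth_on_subset[OF smooth_on_coord_change[OF assms(1,2)] assms(4)]
    by (intro smooth_on_sum smooth_on_scaleR smooth_on_vec_nth assms) auto
next
  fix x assume "x \<in> S"
  then have "point c x \<in> cdom c" "point c x \<in> cdom d"
    using assms(4) point_coord[OF assms(1)] by auto
  then have l: "linear (coord_change c d (point c x))"
    by (intro linear_coord_change assms)
  have "(\<Sum>i\<in>UNIV. e x $ i *\<^sub>R axis i 1) = e x"
    using basis_expansion[of "e x"] by (simp add: scalar_mult_eq_scaleR)
  moreover have "(\<Sum>i\<in>UNIV. e x $ i *\<^sub>R coord_change c d (point c x) (axis i 1))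
      = coord_change c d (point c x) (\<Sum>i\<in>UNIV. e x $ i *\<^sub>R axis i 1)"
    by (simp add: linear_sum[OF l] linear_scale[OF l])
  ultimately show "(\<Sum>i\<in>UNIV. e x $ i *\<^sub>R coord_change c d (point c x) (axis i 1))
      = coord_change c d (point c x) (e x)"
    by (simp only:)
qed

text \<open>Inverse to \<open>field_rep\<close>: the field whose components in the chart
  \<open>c\<close> are \<open>e\<close>. The change to \<open>chart_at A q\<close> is due to the
  storage of tangent vectors; the values matter only on \<open>cdom c\<close>.\<close>

definition field_from :: "('a, 'n) chart \<Rightarrow> (real^'n \<Rightarrow> real^'n) \<Rightarrow> ('a, 'n) vfield" where
  "field_from c e q = coord_change c (chart_at A q) q (e (coord c q))"

lemma components_field_from:
  "c \<in> A \<Longrightarrow> q \<in> cdom c \<Longrightarrow> components A c q (field_from c e q) = e (coord c q)"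
  unfolding field_from_def by (rule components_coord_change)

text \<open>Smoothness is tested in every chart \<open>d\<close>. There the preferred charts cancel
  by the cocycle rule, and what remains is the Jacobian from \<open>c\<close> to \<open>d\<close>
  applied to \<open>e\<close>, composed with the transition map.\<close>

lemma smooth_field_from:
  assumes "c \<in> A" "open U" "U \<subseteq> cdom c" "smooth_on (coord c ` U) e"
  shows "smooth_field A U (field_from c e)"
  unfolding smooth_field_def
proof
  fix d assume d: "d \<in> A"
  let ?S = "coord d ` (cdom d \<inter> U)"
  have S: "open ?S" by (intro open_coord_image d assms)
  have Sd: "?S \<subseteq> coord d ` (cdom d \<inter> cdom c)" using assms(3) by auto
  have tr: "smooth_on ?S (coord c \<circ> point d)"
    by (rule smooth_on_subset[OF smooth_on_transition[OF d assms(1)] Sd])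
  have im: "(coord c \<circ> point d) ` ?S \<subseteq> coord c ` (U \<inter> cdom d)"
    using point_coord[OF d] by auto
  have "smooth_on (coord c ` (cdom c \<inter> (U \<inter> cdom d))) (\<lambda>y. coord_change c d (point c y) (e y))"
    by (rule smooth_on_apply_coord_change[OF assms(1) d open_coord_image[OF assms(1)]])
      (auto intro: open_Int assms(2) open_cdom[OF d] smooth_on_subset[OF assms(4)])
  moreover have "coord c ` (cdom c \<inter> (U \<inter> cdom d)) = coord c ` (U \<inter> cdom d)"
    using assms(3) by auto
  ultimately have "smooth_on ?S (\<lambda>x. coord_change c d (point c ((coord c \<circ> point d) x)) (e ((coord c \<circ> point d) x)))"
    using open_coord_image[OF assms(1), of "U \<inter> cdom d"] assms(2) open_cdom[OF d]
    by (intro smooth_on_compose[OF S _ im tr]) (auto simp: open_Int)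
  then show "smooth_on ?S (field_rep A d (field_from c e))"
  proof (rule smooth_on_cong[OF S])
    fix x assume "x \<in> ?S"
    then obtain q where q: "x = coord d q" "q \<in> cdom d" "q \<in> U" by auto
    then have qc: "q \<in> cdom c" using assms(3) by auto
    show "coord_change c d (point c ((coord c \<circ> point d) x)) (e ((coord c \<circ> point d) x))
        = field_rep A d (field_from c e) x"
      using coord_change_components[OF assms(1) d qc q(2), of "field_from c e q"] q qc
      by (simp add: field_rep_def point_coord[OF d] point_coord[OF assms(1)]
          components_field_from[OF assms(1)])
  qed
qed

section \<open>Restriction, negation and continuity of fields\<close>

lemma smooth_field_subset: "smooth_field A U X \<Longrightarrow> T \<subseteq> U \<Longrightarrow> smooth_field A T X"
  unfolding smooth_field_def
  by (intro ballI, rule smooth_on_subset, drule (1) bspec, assumption, blast)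

lemma smooth_field_minus:
  assumes "open U" "smooth_field A U X"
  shows "smooth_field A U (\<lambda>q. - X q)"
  unfolding smooth_field_def
proof
  fix c assume c: "c \<in> A"
  let ?S = "coord c ` (cdom c \<inter> U)"
  have "smooth_on ?S (\<lambda>x. - field_rep A c X x)"
    using assms(2) c open_coord_image[OF c assms(1)] unfolding smooth_field_def
    by (intro smooth_on_minus) auto
  then show "smooth_on ?S (field_rep A c (\<lambda>q. - X q))"
  proof (rule smooth_on_cong[OF open_coord_image[OF c assms(1)]])
    fix x assume "x \<in> ?S"
    then have "point c x \<in> cdom c" using point_coord[OF c] by auto
    then show "- field_rep A c X x = field_rep A c (\<lambda>q. - X q) x"
      using linear_components[OF c] by (simp add: field_rep_def linear_neg)
  qed
qed

lemma smooth_field_along_minus: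
  assumes "smooth_field_along A S X"
  shows "smooth_field_along A S (\<lambda>q. - X q)"
  unfolding smooth_field_along_def
proof
  fix p assume "p \<in> S"
  then obtain U X' where "open U" "p \<in> U" "smooth_field A U X'" "\<forall>q\<in>U \<inter> S. X' q = X q"
    using assms unfolding smooth_field_along_def by blast
  then show "\<exists>U X'. open U \<and> p \<in> U \<and> smooth_field A U X' \<and> (\<forall>q\<in>U \<inter> S. X' q = - X q)"
    using smooth_field_minus[of U X'] by (intro exI[of _ U] exI[of _ "\<lambda>q. - X' q"]) simp
qed

lemma smooth_field_along_subset:
  assumes "smooth_field_along A S X" "T \<subseteq> S"
  shows "smooth_field_along A T X"
  unfolding smooth_field_along_def
proof
  fix p assume "p \<in> T"
  then obtain U X' where "open U" "p \<in> U" "smooth_field A U X'" "\<forall>q\<in>U \<inter> S. X' q = X q"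
    using assms unfolding smooth_field_along_def by blast
  then show "\<exists>U X'. open U \<and> p \<in> U \<and> smooth_field A U X' \<and> (\<forall>q\<in>U \<inter> T. X' q = X q)"
    using assms(2) by (intro exI[of _ U] exI[of _ X']) auto
qed

text \<open>Near each point of \<open>S\<close> the field agrees on \<open>S\<close> with a smooth
  extension. Components are taken in the fixed chart \<open>c\<close> because the raw values
  \<open>X q\<close> refer to preferred charts that may jump from point to point.\<close>

lemma continuous_on_components:
  assumes "smooth_field_along A S X" "c \<in> A" "S \<subseteq> cdom c"
  shows "continuous_on S (\<lambda>q. components A c q (X q))"
  unfolding continuous_on_eq_continuous_within
proof
  fix q assume q: "q \<in> S"
  then obtain U X' where U: "open U" "q \<in> U" "smooth_field A U X'" "\<forall>r\<in>U \<inter> S. X' r = X r"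
    using assms(1) unfolding smooth_field_along_def by blast
  have "continuous_on (coord c ` (cdom c \<inter> U)) (field_rep A c X')"
    using U(3) assms(2) unfolding smooth_field_def by (blast intro: smooth_on_imp_continuous_on)
  moreover have "continuous_on (cdom c \<inter> U) (coord c)"
    using homeomorphism_cont1[OF homeomorphism_coord[OF assms(2)]] continuous_on_subset by blast
  ultimately have "continuous_on (cdom c \<inter> U) (\<lambda>r. field_rep A c X' (coord c r))"
    by (rule continuous_on_compose2) auto
  then have "continuous (at q) (\<lambda>r. field_rep A c X' (coord c r))"
    using U(1,2) q assms(3) open_cdom[OF assms(2)]
    by (metis IntI continuous_on_eq_continuous_at open_Int subsetD)
  then have "continuous (at q within S) (\<lambda>r. field_rep A c X' (coord c r))"
    by (rule continuous_at_imp_continuous_within)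
  moreover have "field_rep A c X' (coord c q) = components A c q (X q)"
    using U q assms(3) point_coord[OF assms(2)] by (auto simp: field_rep_def)
  ultimately have "((\<lambda>r. field_rep A c X' (coord c r)) \<longlongrightarrow> components A c q (X q)) (at q within S)"
    by (simp add: continuous_within)
  moreover have "eventually (\<lambda>r. field_rep A c X' (coord c r) = components A c r (X r)) (at q within S)"
    unfolding eventually_at_topological using U q assms(3) point_coord[OF assms(2)]
    by (intro exI[of _ U]) (auto simp: field_rep_def)
  ultimately show "continuous (at q within S) (\<lambda>q. components A c q (X q))"
    unfolding continuous_within by (rule Lim_transform_eventually)
qed

section \<open>Directional derivatives and velocities of curves in an arbitrary chart\<close>

lemma dir_deriv_chart:
  assumes "c \<in> A" "q \<in> cdom c" "(f \<circ> point c has_derivative D) (at (coord c q))"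
  shows "dir_deriv A q v f = D (components A c q v)"
proof -
  define d where "d = chart_at A q"
  have d: "d \<in> A" "q \<in> cdom d" using chart_at d_def by auto
  have "coord c q = (coord c \<circ> point d) (coord d q)" using d by (simp add: point_coord)
  then have "((f \<circ> point c) \<circ> (coord c \<circ> point d) has_derivative D \<circ> coord_change d c q) (at (coord d q))"
    using has_derivative_transition[of d c q] assms d by (intro diff_chain_at) auto
  then have "(f \<circ> point d has_derivative D \<circ> coord_change d c q) (at (coord d q))"
    by (rule has_derivative_transform_within_open[where s="coord d ` (cdom d \<inter> cdom c)"])
      (use assms d in \<open>auto intro!: open_coord_image simp: point_coord open_cdom\<close>)
  then have "frechet_derivative (f \<circ> point d) (at (coord d q)) = D \<circ> coord_change d c q"
    by (rule frechet_derivative_at[symmetric])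
  then show ?thesis
    by (simp add: dir_deriv_def components_def d_def Let_def)
qed

lemma tangent_toI:
  assumes "c \<in> A" "q \<in> cdom c" "e > 0" "smooth_on {-e<..<e} \<gamma>"
    and "\<gamma> ` {-e<..<e} \<subseteq> coord c ` cdom c" "point c ` \<gamma> ` {-e<..<e} \<subseteq> S"
    and "\<gamma> 0 = coord c q" "(\<gamma> has_vector_derivative components A c q v) (at 0)"
  shows "v \<in> tangent_to A S q"
proof -
  let ?\<gamma> = "\<lambda>t. point c (\<gamma> t)" and ?I = "{-e<..<e}"
  have cont: "continuous_on ?I \<gamma>" by (rule smooth_on_imp_continuous_on[OF assms(4)])
  have cont': "continuous_on ?I ?\<gamma>"
    using continuous_on_compose2[OF homeomorphism_cont2[OF homeomorphism_coord[OF assms(1)]] cont assms(5)]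
    by simp
  have "smooth_on {t\<in>?I. ?\<gamma> t \<in> cdom d} (coord d \<circ> ?\<gamma>)" if d: "d \<in> A" for d
  proof -
    have "{t\<in>?I. ?\<gamma> t \<in> cdom d} = ?I \<inter> ?\<gamma> -` cdom d" by auto
    then have o: "open {t\<in>?I. ?\<gamma> t \<in> cdom d}"
      using continuous_open_preimage[OF cont' _ open_cdom[OF d]] by simp
    have im: "\<gamma> ` {t\<in>?I. ?\<gamma> t \<in> cdom d} \<subseteq> coord c ` (cdom c \<inter> cdom d)"
    proof
      fix x assume "x \<in> \<gamma> ` {t\<in>?I. ?\<gamma> t \<in> cdom d}"
      then have "x \<in> coord c ` cdom c" "point c x \<in> cdom d" using assms(5) by auto
      then show "x \<in> coord c ` (cdom c \<inter> cdom d)" using point_coord[OF assms(1)] by auto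
    qed
    have "smooth_on {t\<in>?I. ?\<gamma> t \<in> cdom d} \<gamma>" by (rule smooth_on_subset[OF assms(4)]) auto
    then have "smooth_on {t\<in>?I. ?\<gamma> t \<in> cdom d} (\<lambda>t. (coord d \<circ> point c) (\<gamma> t))"
      by (rule smooth_on_compose[OF o open_coord_image[OF assms(1) open_cdom[OF d]] im _
          smooth_on_transition[OF assms(1) d]])
    then show ?thesis by (simp add: o_def)
  qed
  then have "smooth_curve A ?I ?\<gamma>" using cont' by (simp add: smooth_curve_def)
  moreover have "?\<gamma> ` ?I \<subseteq> S" using assms(6) by auto
  moreover have "?\<gamma> 0 = q" using assms(1,2,7) by (simp add: point_coord)
  moreover have "((coord (chart_at A q) \<circ> ?\<gamma>) has_vector_derivative v) (at 0)"
  proof -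
    have "(coord (chart_at A q) \<circ> point c has_derivative coord_change c (chart_at A q) q) (at (\<gamma> 0))"
      using has_derivative_transition[OF assms(1) chart_at(1) assms(2) chart_at(2)] assms(7) by simp
    from diff_chain_at[OF assms(8)[unfolded has_vector_derivative_def] this]
    have "(coord (chart_at A q) \<circ> point c \<circ> \<gamma> has_derivative
        coord_change c (chart_at A q) q \<circ> (\<lambda>t. t *\<^sub>R components A c q v)) (at 0)" .
    moreover have "coord_change c (chart_at A q) q \<circ> (\<lambda>t. t *\<^sub>R components A c q v) = (\<lambda>t. t *\<^sub>R v)"
      using linear_scale[OF linear_coord_change[OF assms(1) chart_at(1) assms(2) chart_at(2)]]
      by (auto simp: from_components[OF assms(1,2)])
    ultimately show ?thesis by (simp add: has_vector_derivative_def o_def)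
  qed
  ultimately show ?thesis
    unfolding tangent_to_def using assms(3) by blast
qed

end

section \<open>The metric and the dual connection in a chart\<close>

lemma has_derivative_matrix_form:
  fixes b c :: "'a::real_normed_vector \<Rightarrow> real^'n" and G :: "'a \<Rightarrow> real^'n^'n"
  assumes b: "(b has_derivative b') (at x)" and c: "(c has_derivative c') (at x)"
    and G: "\<And>i j. ((\<lambda>y. G y $ i $ j) has_derivative G' i j) (at x)"
  shows "((\<lambda>y. b y \<bullet> (G y *v c y)) has_derivative
      (\<lambda>v. b' v \<bullet> (G x *v c x) + b x \<bullet> ((\<chi> i j. G' i j v) *v c x) + b x \<bullet> (G x *v c' v))) (at x)"
proof -
  have bi: "((\<lambda>y. b y $ i) has_derivative (\<lambda>v. b' v $ i)) (at x)" for i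
    by (rule bounded_linear.has_derivative[OF bounded_linear_vec_nth b])
  have cj: "((\<lambda>y. c y $ j) has_derivative (\<lambda>v. c' v $ j)) (at x)" for j
    by (rule bounded_linear.has_derivative[OF bounded_linear_vec_nth c])
  have "((\<lambda>y. \<Sum>i\<in>UNIV. b y $ i * (\<Sum>j\<in>UNIV. G y $ i $ j * c y $ j)) has_derivative
      (\<lambda>v. \<Sum>i\<in>UNIV. b x $ i * (\<Sum>j\<in>UNIV. G x $ i $ j * c' v $ j + G' i j v * c x $ j)
         + b' v $ i * (\<Sum>j\<in>UNIV. G x $ i $ j * c x $ j))) (at x)"
    by (intro has_derivative_sum has_derivative_mult bi cj G)
  then show ?thesis
    by (simp add: inner_vec_def matrix_vector_mult_def sum.distrib distrib_left add_ac)
qed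

locale smooth_metric = smooth_manifold A
  for A :: "('a::{t2_space,second_countable_topology}, 'n::finite) chart set" +
  fixes g :: "('a, 'n) tensor2"
  assumes smooth_symmetric: "smooth_symmetric_tensor A g"
begin

lemma bilinear_metric: "bilinear (g q)"
  using smooth_symmetric by (simp add: smooth_symmetric_tensor_def)

lemma metric_commute: "g q u v = g q v u"
  using smooth_symmetric by (simp add: smooth_symmetric_tensor_def)

lemma metric_matrix_symmetric: "transpose (metric_matrix A g c q) = metric_matrix A g c q"
  by (auto simp: transpose_def metric_matrix_def vec_eq_iff metric_commute)

lemma metric_matrix_self_adjoint:
  "u \<bullet> (metric_matrix A g c q *v v) = (metric_matrix A g c q *v u) \<bullet> v"
  using dot_lmul_matrix[of u "metric_matrix A g c q" v] transpose_matrix_vector[of "metric_matrix A g c q" u]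
  by (simp add: metric_matrix_symmetric)

lemma smooth_on_metric_matrix:
  "c \<in> A \<Longrightarrow> smooth_on (coord c ` cdom c) (\<lambda>x. metric_matrix A g c (point c x) $ i $ j)"
  using smooth_symmetric by (simp add: smooth_symmetric_tensor_def)

lemma smooth_on_det_metric_matrix:
  "c \<in> A \<Longrightarrow> smooth_on (coord c ` cdom c) (\<lambda>x. det (metric_matrix A g c (point c x)))"
  using is_chart[of c] by (intro smooth_on_det smooth_on_metric_matrix) (auto simp: is_chart_def)

lemma metric_in_chart:
  assumes "c \<in> A" "q \<in> cdom c"
  shows "g q u v = components A c q u \<bullet> (metric_matrix A g c q *v components A c q v)"
proof -
  have expand: "w = (\<Sum>a\<in>UNIV. components A c q w $ a *\<^sub>R coord_vector A c q a)" for w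
  proof -
    note l = linear_coord_change[OF assms(1) chart_at(1) assms(2) chart_at(2)]
    have "(\<Sum>a\<in>UNIV. components A c q w $ a *\<^sub>R coord_vector A c q a)
        = coord_change c (chart_at A q) q (\<Sum>a\<in>UNIV. components A c q w $ a *s axis a 1)"
      by (simp add: coord_vector_def linear_sum[OF l] linear_scale[OF l] scalar_mult_eq_scaleR)
    also have "\<dots> = w"
      by (simp only: basis_expansion from_components[OF assms])
    finally show ?thesis by simp
  qed
  have l: "linear (\<lambda>w. g q w v')" "linear (g q v')" for v'
    using bilinear_metric by (auto simp: bilinear_def)
  have "g q (\<Sum>a\<in>UNIV. r a *\<^sub>R e a) (\<Sum>b\<in>UNIV. s b *\<^sub>R e b)
      = (\<Sum>a\<in>UNIV. r a * (\<Sum>b\<in>UNIV. g q (e a) (e b) * s b))" for r s and e :: "'n \<Rightarrow> real^'n"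
    by (simp only: linear_sum[OF l(1)] linear_scale[OF l(1)])
      (simp add: linear_sum[OF l(2)] linear_scale[OF l(2)] mult.commute)
  from this[of "($) (components A c q u)" "coord_vector A c q" "($) (components A c q v)"]
  show ?thesis
    unfolding expand[symmetric] by (simp add: inner_vec_def matrix_vector_mult_def metric_matrix_def)
qed

lemma rad_in_chart:
  assumes "c \<in> A" "q \<in> cdom c"
  shows "v \<in> rad g q \<longleftrightarrow> metric_matrix A g c q *v components A c q v = 0"
proof
  assume v: "v \<in> rad g q"
  have "u \<bullet> (metric_matrix A g c q *v components A c q v) = 0" for u
  proof -
    let ?w = "coord_change c (chart_at A q) q u"
    have "g q ?w v = 0" using v by (simp add: rad_def metric_commute[of q ?w])
    then show ?thesis
      using metric_in_chart[OF assms, of ?w v] by (simp add: components_coord_change[OF assms])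
  qed
  from this[of "metric_matrix A g c q *v components A c q v"]
  show "metric_matrix A g c q *v components A c q v = 0" by simp
next
  assume "metric_matrix A g c q *v components A c q v = 0"
  then show "v \<in> rad g q"
    by (simp add: rad_def metric_in_chart[OF assms] metric_matrix_self_adjoint)
qed

text \<open>The rank in \<open>form_rank\<close> is that of the matrix in the preferred chart. The
  existence of a nonzero radical vector does not refer to charts, so vanishing of the determinant in
  either chart is compared with it.\<close>

lemma singular_set_in_chart:
  assumes "c \<in> A" "q \<in> cdom c"
  shows "q \<in> singular_set g \<longleftrightarrow> det (metric_matrix A g c q) = 0"
proof -
  let ?d = "chart_at A q"
  note d = chart_at[of q]
  have iff: "det (metric_matrix A g c q) = 0 \<longleftrightarrow> (\<exists>v. v \<noteq> 0 \<and> v \<in> rad g q)"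
    if c: "c \<in> A" "q \<in> cdom c" for c
  proof
    assume "det (metric_matrix A g c q) = 0"
    then obtain u where u: "u \<noteq> 0" "metric_matrix A g c q *v u = 0"
      using det_nonzero_iff_kernel by blast
    let ?v = "coord_change c ?d q u"
    have v: "components A c q ?v = u" by (rule components_coord_change[OF c])
    then have "?v \<in> rad g q" using u(2) rad_in_chart[OF c] by simp
    moreover have "?v \<noteq> 0" using v u(1) linear_0[OF linear_components[OF c]] by auto
    ultimately show "\<exists>v. v \<noteq> 0 \<and> v \<in> rad g q" by blast
  next
    assume "\<exists>v. v \<noteq> 0 \<and> v \<in> rad g q"
    then obtain v where v: "v \<noteq> 0" "v \<in> rad g q" by blast
    have "components A c q v \<noteq> 0"
    proof
      assume "components A c q v = 0"
      then have "v = 0"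
        using from_components[OF c, of v] linear_0[OF linear_coord_change[OF c(1) d(1) c(2) d(2)]] by simp
      then show False using v by simp
    qed
    then show "det (metric_matrix A g c q) = 0"
      using v rad_in_chart[OF c] det_nonzero_iff_kernel by blast
  qed
  have "coord_vector A ?d q a = axis a 1" for a
    unfolding coord_vector_def by (rule coord_change_self[OF d])
  then have "q \<in> singular_set g \<longleftrightarrow> det (metric_matrix A g ?d q) = 0"
    by (simp add: singular_set_def form_rank_def det_eq_0_rank metric_matrix_def)
  then show ?thesis using iff[OF assms] iff[OF d] by simp
qed

text \<open>Not tensorial: it is taken in the preferred chart at \<open>q\<close>, in whose
  components the tangent vectors at \<open>q\<close> are stored, so that it can be contracted with
  them directly.\<close>

definition metric_derivative :: "'a \<Rightarrow> real^'n \<Rightarrow> real^'n^'n" where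
  "metric_derivative q v = (\<chi> i j. frechet_derivative
     (\<lambda>x. metric_matrix A g (chart_at A q) (point (chart_at A q) x) $ i $ j)
     (at (coord (chart_at A q) q)) v)"

definition christoffel :: "'a \<Rightarrow> real^'n \<Rightarrow> real^'n \<Rightarrow> real^'n \<Rightarrow> real" where
  "christoffel q u v w =
     (v \<bullet> (metric_derivative q u *v w) + w \<bullet> (metric_derivative q v *v u)
      - u \<bullet> (metric_derivative q w *v v)) / 2"

lemma metric_derivative_symmetric: "transpose (metric_derivative q v) = metric_derivative q v"
proof -
  have "(\<lambda>x. metric_matrix A g c (point c x) $ i $ j) = (\<lambda>x. metric_matrix A g c (point c x) $ j $ i)"
    for c i j
    by (rule ext) (simp add: metric_matrix_def, rule metric_commute)
  from this[of "chart_at A q"] show ?thesis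
    unfolding transpose_def metric_derivative_def vec_eq_iff vec_lambda_beta
    by (intro allI) (simp only:)
qed

lemma metric_derivative_self_adjoint:
  "u \<bullet> (metric_derivative q w *v v) = v \<bullet> (metric_derivative q w *v u)"
  using dot_lmul_matrix[of u "metric_derivative q w" v]
    transpose_matrix_vector[of "metric_derivative q w" u]
  by (simp add: metric_derivative_symmetric inner_commute)

lemma has_derivative_metric_matrix:
  assumes "q \<in> cdom c" "c \<in> A"
  shows "((\<lambda>x. metric_matrix A g c (point c x) $ i $ j) has_derivative
    frechet_derivative (\<lambda>x. metric_matrix A g c (point c x) $ i $ j) (at (coord c q))) (at (coord c q))"
  by (rule smooth_on_has_derivative[OF smooth_on_metric_matrix]) (use assms in auto)

lemma metric_derivative_linear: "linear (metric_derivative q)"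
proof -
  let ?c = "chart_at A q"
  have "linear (frechet_derivative (\<lambda>x. metric_matrix A g ?c (point ?c x) $ i $ j) (at (coord ?c q)))" for i j
    using has_derivative_linear[OF has_derivative_metric_matrix] chart_at by blast
  then show ?thesis
    unfolding metric_derivative_def
    by (intro linearI) (auto simp: vec_eq_iff linear_add linear_scale)
qed

lemma field_rep_chart_at: "field_rep A (chart_at A q) X (coord (chart_at A q) q) = X q"
  by (simp add: field_rep_def point_coord chart_at components_chart_at)

lemma has_derivative_field_rep:
  assumes "open U" "q \<in> U" "smooth_field A U X" "c \<in> A" "q \<in> cdom c"
  shows "(field_rep A c X has_derivative frechet_derivative (field_rep A c X) (at (coord c q)))
    (at (coord c q))"
  using assms unfolding smooth_field_def
  by (intro smooth_on_has_derivative[of "coord c ` (cdom c \<inter> U)"]) auto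

lemma dir_deriv_metric:
  assumes "open U" "q \<in> U" "smooth_field A U X" "smooth_field A U Y"
  shows "dir_deriv A q v (\<lambda>r. g r (X r) (Y r)) =
      g q (frechet_derivative (field_rep A (chart_at A q) X) (at (coord (chart_at A q) q)) v) (Y q)
      + X q \<bullet> (metric_derivative q v *v Y q)
      + g q (X q) (frechet_derivative (field_rep A (chart_at A q) Y) (at (coord (chart_at A q) q)) v)"
proof -
  define c where "c = chart_at A q"
  have c: "c \<in> A" "q \<in> cdom c" using chart_at c_def by auto
  let ?x = "coord c q"
  have "((\<lambda>x. field_rep A c X x \<bullet> (metric_matrix A g c (point c x) *v field_rep A c Y x)) has_derivative
      (\<lambda>v. frechet_derivative (field_rep A c X) (at ?x) v \<bullet> (metric_matrix A g c (point c ?x) *v field_rep A c Y ?x)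
        + field_rep A c X ?x \<bullet> ((\<chi> i j. frechet_derivative (\<lambda>x. metric_matrix A g c (point c x) $ i $ j) (at ?x) v)
            *v field_rep A c Y ?x)
        + field_rep A c X ?x \<bullet> (metric_matrix A g c (point c ?x) *v frechet_derivative (field_rep A c Y) (at ?x) v)))
      (at ?x)"
    by (intro has_derivative_matrix_form has_derivative_field_rep[OF assms(1,2)] assms c has_derivative_metric_matrix)
  then have "((\<lambda>r. g r (X r) (Y r)) \<circ> point c has_derivative
      (\<lambda>v. frechet_derivative (field_rep A c X) (at ?x) v \<bullet> (metric_matrix A g c (point c ?x) *v field_rep A c Y ?x)
        + field_rep A c X ?x \<bullet> ((\<chi> i j. frechet_derivative (\<lambda>x. metric_matrix A g c (point c x) $ i $ j) (at ?x) v)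
            *v field_rep A c Y ?x)
        + field_rep A c X ?x \<bullet> (metric_matrix A g c (point c ?x) *v frechet_derivative (field_rep A c Y) (at ?x) v)))
      (at ?x)"
    by (rule has_derivative_transform_within_open[where s="coord c ` cdom c"])
      (use c open_coord_image[OF c(1) open_UNIV] point_coord[OF c(1)] in
        \<open>auto simp: metric_in_chart[OF c(1)] field_rep_def\<close>)
  from dir_deriv_chart[OF c this, of v] show ?thesis
    by (simp add: metric_in_chart[OF c] c_def components_chart_at field_rep_chart_at
        metric_derivative_def point_coord chart_at)
qed

text \<open>In the Koszul formula the terms differentiating \<open>Z\<close> cancel, and so do those
  differentiating \<open>X\<close> and \<open>Y\<close> in the direction of \<open>Z\<close>.
  Besides the Christoffel terms only the pairing of the derivative of \<open>Y\<close> along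
  \<open>X\<close> with \<open>Z q\<close> remains, and it vanishes because \<open>Z q\<close> is
  radical.\<close>

lemma dual_connection_radical:
  assumes "open U" "q \<in> U" "smooth_field A U X" "smooth_field A U Y" "smooth_field A U Z"
    and "Z q \<in> rad g q"
  shows "dual_connection A g X Y Z q = christoffel q (X q) (Y q) (Z q)"
proof -
  let ?D = "\<lambda>X. frechet_derivative (field_rep A (chart_at A q) X) (at (coord (chart_at A q) q))"
  have br: "lie_bracket A X Y q = ?D Y (X q) - ?D X (Y q)" for X Y
    by (simp add: lie_bracket_def Let_def)
  have Z: "g q (Z q) u = 0" "g q u (Z q) = 0" for u
    using assms(6) metric_commute[of q u] by (auto simp: rad_def)
  have diff: "g q (u - v) w = g q u w - g q v w" for u v w
    by (rule bilinear_lsub[OF bilinear_metric])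
  have com: "g q (X q) u = g q u (X q)" "g q (Y q) u = g q u (Y q)" for u
    by (rule metric_commute)+
  show ?thesis
    unfolding dual_connection_def christoffel_def
    by (simp only: dir_deriv_metric[OF assms(1,2)] assms(3-5) br Z diff com)
      (simp add: Z com algebra_simps)
qed

text \<open>The field is given only along the part of the hypersurface in \<open>V\<close>, while
  \<open>extends_near\<close> demands agreement on all of the hypersurface in \<open>U\<close>;
  intersecting the domain with \<open>V\<close> reconciles the two.\<close>

lemma local_extension:
  assumes "smooth_field_along A (singular_set g \<inter> V) X" "open V" "q \<in> singular_set g \<inter> V"
  obtains U X' where "open U" "q \<in> U" "extends_near A (singular_set g) U X X'"
proof -
  obtain U X' where U: "open U" "q \<in> U" "smooth_field A U X'" "\<forall>r\<in>U \<inter> (singular_set g \<inter> V). X' r = X r"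
    using assms(1,3) unfolding smooth_field_along_def by blast
  then have "extends_near A (singular_set g) (U \<inter> V) X X'"
    using smooth_field_subset[OF U(3), of "U \<inter> V"] by (auto simp: extends_near_def)
  then show thesis using that U assms by blast
qed

text \<open>The definite description is well posed: extensions exist on a common neighbourhood, and
  any extensions give the Christoffel value, which involves the fields at \<open>q\<close> alone.
  The three sets allow fields with different domains.\<close>

lemma dual_connection_along_radical:
  assumes "smooth_field_along A (singular_set g \<inter> V1) X" "open V1" "q \<in> V1"
    and "smooth_field_along A (singular_set g \<inter> V2) Y" "open V2" "q \<in> V2"
    and "smooth_field_along A (singular_set g \<inter> V3) Z" "open V3" "q \<in> V3"
    and "q \<in> singular_set g" "Z q \<in> rad g q"
  shows "dual_connection_along A g X Y Z q = christoffel q (X q) (Y q) (Z q)"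
  unfolding dual_connection_along_def
proof (rule the_equality)
  obtain U1 X' where 1: "open U1" "q \<in> U1" "extends_near A (singular_set g) U1 X X'"
    using local_extension[OF assms(1,2)] assms(3,10) by blast
  obtain U2 Y' where 2: "open U2" "q \<in> U2" "extends_near A (singular_set g) U2 Y Y'"
    using local_extension[OF assms(4,5)] assms(6,10) by blast
  obtain U3 Z' where 3: "open U3" "q \<in> U3" "extends_near A (singular_set g) U3 Z Z'"
    using local_extension[OF assms(7,8)] assms(9,10) by blast
  define U where "U = U1 \<inter> U2 \<inter> U3"
  have U: "open U" "q \<in> U" using 1 2 3 by (auto simp: U_def)
  have sm: "smooth_field A U X'" "smooth_field A U Y'" "smooth_field A U Z'"
    using 1 2 3 by (auto simp: U_def extends_near_def intro: smooth_field_subset)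
  have eq: "X' q = X q" "Y' q = Y q" "Z' q = Z q"
    using 1 2 3 assms(10) by (auto simp: extends_near_def)
  have "christoffel q (X q) (Y q) (Z q) = dual_connection A g X' Y' Z' q"
    using dual_connection_radical[OF U sm] eq assms(11) by simp
  moreover have "extends_near A (singular_set g) U X X'" "extends_near A (singular_set g) U Y Y'"
    "extends_near A (singular_set g) U Z Z'"
    using 1 2 3 sm by (auto simp: U_def extends_near_def)
  ultimately show "\<exists>U X' Y' Z'. open U \<and> q \<in> U \<and> extends_near A (singular_set g) U X X' \<and>
      extends_near A (singular_set g) U Y Y' \<and> extends_near A (singular_set g) U Z Z' \<and>
      christoffel q (X q) (Y q) (Z q) = dual_connection A g X' Y' Z' q"
    using U by (intro exI conjI)
next
  fix h
  assume "\<exists>U X' Y' Z'. open U \<and> q \<in> U \<and> extends_near A (singular_set g) U X X' \<and>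
      extends_near A (singular_set g) U Y Y' \<and> extends_near A (singular_set g) U Z Z' \<and>
      h = dual_connection A g X' Y' Z' q"
  then obtain U X' Y' Z' where U: "open U" "q \<in> U" "extends_near A (singular_set g) U X X'"
    "extends_near A (singular_set g) U Y Y'" "extends_near A (singular_set g) U Z Z'"
    "h = dual_connection A g X' Y' Z' q"
    by (elim exE conjE)
  then have "X' q = X q" "Y' q = Y q" "Z' q = Z q" "smooth_field A U X'" "smooth_field A U Y'" "smooth_field A U Z'"
    using assms(10) by (auto simp: extends_near_def)
  then show "h = christoffel q (X q) (Y q) (Z q)"
    using dual_connection_radical[OF U(1,2)] U(6) assms(11) by simp
qed

section \<open>Main normals and the second fundamental form on radical vectors\<close>

lemma main_normal_subset:
  assumes "main_normal A g V N" "W \<subseteq> V"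
  shows "main_normal A g W N"
proof -
  have "smooth_field_along A (singular_set g \<inter> W) N"
    by (rule smooth_field_along_subset[where S="singular_set g \<inter> V"])
      (use assms in \<open>auto simp: main_normal_def\<close>)
  moreover have "\<forall>V' R. open V' \<and> V' \<subseteq> W \<and> radical_field A g V' R \<longrightarrow>
      (\<forall>q\<in>singular_set g \<inter> V'. II A g R N N q = 0)"
    using assms order_trans[of _ W V] unfolding main_normal_def by meson
  ultimately show ?thesis
    using assms unfolding main_normal_def by (simp add: subset_eq)
qed

text \<open>\<open>christoffel\<close> is linear in each of its first two arguments, so the two
  signs in the condition on \<open>II\<close> cancel.\<close>

lemma main_normal_minus:
  assumes "main_normal A g V N" "open V"
  shows "main_normal A g V (\<lambda>q. - N q)"
proof -
  have N: "smooth_field_along A (singular_set g \<inter> V) N" using assms by (simp add: main_normal_def)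
  have "II A g R (\<lambda>q. - N q) (\<lambda>q. - N q) q = 0"
    if V': "open V'" "V' \<subseteq> V" "radical_field A g V' R" and q: "q \<in> singular_set g \<inter> V'" for V' R q
  proof -
    have R: "smooth_field_along A (singular_set g \<inter> V') R" "R q \<in> rad g q"
      using V' q by (auto simp: radical_field_def)
    have qV: "q \<in> V" "q \<in> V'" "q \<in> singular_set g" using q V' by auto
    have "(- M) *v w = - (M *v w)" for M :: "real^'n^'n" and w
      by (simp add: matrix_vector_mult_def vec_eq_iff sum_negf)
    then have "christoffel q (- N q) (- N q) (R q) = christoffel q (N q) (N q) (R q)"
      using linear_neg[OF metric_derivative_linear, of q "N q"]
      by (simp add: christoffel_def linear_neg[OF matrix_vector_mul_linear])
    moreover have "II A g R N N q = 0" using assms(1) V' q unfolding main_normal_def by simp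
    ultimately show ?thesis
      unfolding II_def
      using dual_connection_along_radical[OF N assms(2) qV(1) N assms(2) qV(1) R(1) V'(1) qV(2,3) R(2)]
        dual_connection_along_radical[OF smooth_field_along_minus[OF N] assms(2) qV(1)
          smooth_field_along_minus[OF N] assms(2) qV(1) R(1) V'(1) qV(2,3) R(2)]
      by simp
  qed
  then have "\<forall>V' R. open V' \<and> V' \<subseteq> V \<and> radical_field A g V' R \<longrightarrow>
      (\<forall>q\<in>singular_set g \<inter> V'. II A g R (\<lambda>q. - N q) (\<lambda>q. - N q) q = 0)"
    by blast
  moreover have "g q (- u) v = - g q u v" "g q u (- v) = - g q u v" for q u v
    using bilinear_lneg[OF bilinear_metric] bilinear_rneg[OF bilinear_metric] by auto
  ultimately show ?thesis
    using assms smooth_field_along_minus[OF N] unfolding main_normal_def by simp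
qed

text \<open>When the first and last arguments of \<open>christoffel\<close> agree, two of its terms
  cancel by symmetry and only the derivative of the metric along the normal survives. At
  \<open>q\<close> this equals the derivative of \<open>g r (E r) (E r)\<close>, since derivatives
  of \<open>E\<close> are paired with the radical vector \<open>E q\<close>. The relation between
  \<open>X\<close> and \<open>E\<close> is needed at \<open>q\<close> only.\<close>

lemma second_ff_radical:
  assumes "smooth_field_along A (singular_set g \<inter> V1) X" "open V1" "q \<in> V1"
    and "smooth_field_along A (singular_set g \<inter> V2) N" "open V2" "q \<in> V2"
    and "q \<in> singular_set g" "open U" "q \<in> U" "smooth_field A U E" "E q \<in> rad g q"
    and X: "X q = f *\<^sub>R E q"
  shows "second_ff A g N X X q = - f\<^sup>2 * dir_deriv A q (N q) (\<lambda>r. g r (E r) (E r)) / 2"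
proof -
  have E: "g q (E q) u = 0" "g q u (E q) = 0" for u
    using assms(11) metric_commute[of q u] by (auto simp: rad_def)
  have "X q \<in> rad g q"
    using assms(11) bilinear_lmul[OF bilinear_metric] by (simp add: X rad_def)
  then have "second_ff A g N X X q = - christoffel q (X q) (N q) (X q)"
    unfolding second_ff_def using dual_connection_along_radical[OF assms(1-6) assms(1-3,7)] by simp
  also have "christoffel q (X q) (N q) (X q) = X q \<bullet> (metric_derivative q (N q) *v X q) / 2"
    using metric_derivative_self_adjoint[of "N q" q "X q" "X q"] by (simp add: christoffel_def)
  also have "\<dots> = f\<^sup>2 * (E q \<bullet> (metric_derivative q (N q) *v E q)) / 2"
    by (simp add: X matrix_vector_mult_scaleR power2_eq_square)
  also have "E q \<bullet> (metric_derivative q (N q) *v E q) = dir_deriv A q (N q) (\<lambda>r. g r (E r) (E r))"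
    by (simp add: dir_deriv_metric[OF assms(8,9,10,10)] E)
  finally show ?thesis by simp
qed

end

section \<open>Radical fields on a transverse singular space\<close>

lemma connected_nonzero_sign:
  fixes f :: "'a::topological_space \<Rightarrow> real"
  assumes "connected S" "continuous_on S f" "\<And>x. x \<in> S \<Longrightarrow> f x \<noteq> 0"
  shows "(\<forall>x\<in>S. f x > 0) \<or> (\<forall>x\<in>S. f x < 0)"
proof (rule ccontr)
  assume "\<not> ?thesis"
  then obtain x y where xy: "x \<in> S" "y \<in> S" "f x \<le> 0" "f y \<ge> 0"
    using not_less by blast
  have "connected (f ` S)" by (rule connected_continuous_image[OF assms(2,1)])
  then have "0 \<in> f ` S"
    using xy unfolding connected_iff_interval by blast
  then show False using assms(3) by auto
qed

lemma smooth_on_frechet_derivative_apply: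
  fixes F :: "real^'n \<Rightarrow> real"
  assumes "open S" "smooth_on S F" "smooth_on S n"
  shows "smooth_on S (\<lambda>x. frechet_derivative F (at x) (n x))"
proof (rule smooth_on_cong[OF assms(1)])
  show "smooth_on S (\<lambda>x. \<Sum>i\<in>UNIV. n x $ i * frechet_derivative F (at x) (axis i 1))"
    using assms by (intro smooth_on_sum smooth_on_mult smooth_on_vec_nth smooth_on_frechet_derivative)
next
  fix x assume "x \<in> S"
  then have l: "linear (frechet_derivative F (at x))"
    using has_derivative_linear[OF smooth_on_has_derivative[OF assms(2)]] by blast
  have "(\<Sum>i\<in>UNIV. n x $ i * frechet_derivative F (at x) (axis i 1))
      = frechet_derivative F (at x) (\<Sum>i\<in>UNIV. n x $ i *s axis i 1)"
    by (simp add: linear_sum[OF l] linear_scale[OF l] scalar_mult_eq_scaleR)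
  then show "(\<Sum>i\<in>UNIV. n x $ i * frechet_derivative F (at x) (axis i 1))
      = frechet_derivative F (at x) (n x)"
    by (simp only: basis_expansion)
qed

locale transverse_metric = smooth_metric A g
  for A :: "('a::{t2_space,second_countable_topology}, 'n::finite) chart set"
    and g :: "('a, 'n) tensor2" +
  assumes transverse: "\<And>c q. c \<in> A \<Longrightarrow> q \<in> singular_set g \<Longrightarrow> q \<in> cdom c \<Longrightarrow>
    frechet_derivative (\<lambda>x. det (metric_matrix A g c (point c x))) (at (coord c q)) \<noteq> (\<lambda>v. 0)"
begin

definition det_differential :: "('a, 'n) chart \<Rightarrow> 'a \<Rightarrow> real^'n \<Rightarrow> real" where
  "det_differential c q v = frechet_derivative (\<lambda>x. det (metric_matrix A g c (point c x)))
     (at (coord c q)) (components A c q v)"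

lemma open_coords: "c \<in> A \<Longrightarrow> open (coord c ` cdom c)"
  using is_chart by (simp add: is_chart_def)

lemma linear_det_differential:
  assumes "c \<in> A" "q \<in> cdom c"
  shows "linear (det_differential c q)"
proof -
  have "linear (frechet_derivative (\<lambda>x. det (metric_matrix A g c (point c x))) (at (coord c q)))"
    by (rule has_derivative_linear[OF smooth_on_has_derivative[OF smooth_on_det_metric_matrix]])
      (use assms in auto)
  from linear_compose[OF linear_components[OF assms] this]
  show ?thesis by (simp add: o_def det_differential_def[abs_def])
qed

text \<open>Of the description of the tangent space as the kernel of the differential, this
  inclusion is what serves below: it is applied to a normal and to a combination of two
  normals.\<close>

lemma tangent_to_singular_set:
  assumes "c \<in> A" "q \<in> cdom c" "q \<in> singular_set g" "det_differential c q v = 0"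
  shows "v \<in> tangent_to A (singular_set g) q"
proof -
  let ?F = "\<lambda>x. det (metric_matrix A g c (point c x))"
  have "?F (coord c q) = 0"
    using assms by (simp add: point_coord singular_set_in_chart)
  moreover have "coord c q \<in> coord c ` cdom c" using assms(2) by simp
  ultimately obtain e \<gamma> where e: "e > 0" "smooth_on {-e<..<e} \<gamma>" "\<gamma> ` {-e<..<e} \<subseteq> coord c ` cdom c"
    "\<And>t. t \<in> {-e<..<e} \<Longrightarrow> ?F (\<gamma> t) = 0" "\<gamma> 0 = coord c q"
    "(\<gamma> has_vector_derivative components A c q v) (at 0)"
    using zero_set_curve[OF open_coords[OF assms(1)] smooth_on_det_metric_matrix[OF assms(1)] _ _
        transverse[OF assms(1,3,2)] assms(4)[unfolded det_differential_def]] by metis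
  have "point c ` \<gamma> ` {-e<..<e} \<subseteq> singular_set g"
  proof
    fix r assume "r \<in> point c ` \<gamma> ` {-e<..<e}"
    then obtain t where t: "t \<in> {-e<..<e}" "r = point c (\<gamma> t)" by blast
    then have "\<gamma> t \<in> coord c ` cdom c" using e(3) by blast
    then show "r \<in> singular_set g"
      using singular_set_in_chart[OF assms(1) point_in_cdom[OF assms(1)]] e(4)[OF t(1)] t(2) by simp
  qed
  from tangent_toI[OF assms(1,2) e(1-3) this e(5,6)] show ?thesis .
qed

text \<open>A normal annihilated by the differential would be tangent, hence orthogonal to itself,
  against the normalization to \<open>1\<close> or \<open>-1\<close>.\<close>

lemma normal_det_differential_nonzero:
  assumes "main_normal A g V N" "c \<in> A" "q \<in> cdom c" "q \<in> singular_set g" "q \<in> V"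
  shows "det_differential c q (N q) \<noteq> 0"
proof
  assume "det_differential c q (N q) = 0"
  then have "N q \<in> tangent_to A (singular_set g) q"
    by (rule tangent_to_singular_set[OF assms(2-4)])
  then show False using assms(1,4,5) unfolding main_normal_def by fastforce
qed

text \<open>Splitting \<^term>\<open>N'' = a *\<^sub>R N + t\<close> with \<^term>\<open>t\<close> tangent, both
  \<^term>\<open>g q (N'' q) (N'' q)\<close> and \<^term>\<open>a\<^sup>2 * g q (N q) (N q)\<close> agree, since both fields are
  orthogonal to \<^term>\<open>t\<close>.\<close>

lemma normal_det_differential_unique:
  assumes "main_normal A g W N" "main_normal A g W N''"
    and "c \<in> A" "q \<in> cdom c" "q \<in> singular_set g" "q \<in> W"
  obtains a where "a\<^sup>2 = (1::real)" "det_differential c q (N'' q) = a * det_differential c q (N q)"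
proof -
  note l = linear_det_differential[OF assms(3,4)]
  have nz: "det_differential c q (N q) \<noteq> 0"
    by (rule normal_det_differential_nonzero[OF assms(1,3-6)])
  \<comment> \<open>The ratio that puts the remainder \<open>t\<close> into the kernel of the
    differential.\<close>
  define a where "a = det_differential c q (N'' q) / det_differential c q (N q)"
  define t where "t = N'' q - a *\<^sub>R N q"
  have "det_differential c q t = 0"
    using nz by (simp add: t_def a_def linear_diff[OF l] linear_scale[OF l])
  then have "t \<in> tangent_to A (singular_set g) q"
    by (rule tangent_to_singular_set[OF assms(3-5)])
  then have t: "g q (N q) t = 0" "g q (N'' q) t = 0"
    using assms unfolding main_normal_def by auto
  have N'': "N'' q = a *\<^sub>R N q + t" by (simp add: t_def)
  note b = bilinear_ladd[OF bilinear_metric] bilinear_radd[OF bilinear_metric]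
    bilinear_lmul[OF bilinear_metric] bilinear_rmul[OF bilinear_metric]
  have "g q (N'' q) (N'' q) = g q (N'' q) (a *\<^sub>R N q) + g q (N'' q) t"
    by (subst (2) N'') (rule b(2))
  also have "\<dots> = a * g q (N q) (N'' q)"
    by (simp add: b t metric_commute[of q "N'' q" "N q"])
  also have "\<dots> = a\<^sup>2 * g q (N q) (N q)"
    by (simp add: N'' b t power2_eq_square)
  finally have eq: "g q (N'' q) (N'' q) = a\<^sup>2 * g q (N q) (N q)" .
  moreover have "g q (N q) (N q) = 1 \<or> g q (N q) (N q) = -1" "g q (N'' q) (N'' q) = 1 \<or> g q (N'' q) (N'' q) = -1"
    using assms unfolding main_normal_def by auto
  \<comment> \<open>The two normals are not yet known to have squares of the same sign; the value
    \<open>-1\<close> is excluded because \<open>a\<close> is real.\<close>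
  ultimately have "a\<^sup>2 = 1 \<or> a\<^sup>2 = -1" by (elim disjE; simp only:; linarith)
  then have "a\<^sup>2 = 1" using zero_le_power2[of a] by linarith
  moreover have "det_differential c q (N'' q) = a * det_differential c q (N q)"
    using nz by (simp add: a_def)
  ultimately show thesis by (rule that)
qed

text \<open>Defined on the whole chart domain although radical only on the hypersurface, so that it
  can be differentiated in the normal direction.\<close>

definition radical_frame :: "('a, 'n) chart \<Rightarrow> 'n \<Rightarrow> ('a, 'n) vfield" where
  "radical_frame c k = field_from c (\<lambda>x. cofactor_row k (metric_matrix A g c (point c x)))"

lemma smooth_on_cofactor_row:
  assumes "c \<in> A"
  shows "smooth_on (coord c ` cdom c) (\<lambda>x. cofactor_row k (metric_matrix A g c (point c x)))"
proof -
  have "smooth_on (coord c ` cdom c)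
      (\<lambda>x. (\<chi> a. if a = k then axis i 1 else metric_matrix A g c (point c x) $ a) $ j $ l)" for i j l
    using smooth_on_metric_matrix[OF assms, of j l]
    by (cases "j = k") (auto intro: smooth_on_const open_coords[OF assms])
  then show ?thesis
    unfolding cofactor_row_def
    by (intro smooth_on_vec_lambda smooth_on_det open_coords[OF assms])
qed

section \<open>The radical frame where a diagonal cofactor does not vanish\<close>

context
  fixes c k W
  assumes c: "c \<in> A" and W: "open W" "W \<subseteq> cdom c"
    and diag: "\<And>q. q \<in> W \<Longrightarrow> cofactor_row k (metric_matrix A g c q) $ k \<noteq> 0"
begin

lemma components_radical_frame:
  "q \<in> cdom c \<Longrightarrow> components A c q (radical_frame c k q) = cofactor_row k (metric_matrix A g c q)"
  unfolding radical_frame_def by (simp add: components_field_from[OF c] point_coord[OF c])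

lemma smooth_radical_frame: "smooth_field A W (radical_frame c k)"
  unfolding radical_frame_def
  by (rule smooth_field_from[OF c W]) (use W in \<open>auto intro: smooth_on_subset[OF smooth_on_cofactor_row[OF c]]\<close>)

lemma radical_frame_in_rad: "q \<in> singular_set g \<Longrightarrow> q \<in> W \<Longrightarrow> radical_frame c k q \<in> rad g q"
  using W(2) by (auto simp: rad_in_chart[OF c] components_radical_frame matrix_mult_cofactor_row
      singular_set_in_chart[OF c])

lemma rad_eq_span_radical_frame:
  assumes "q \<in> singular_set g" "q \<in> W" "v \<in> rad g q"
  obtains f where "v = f *\<^sub>R radical_frame c k q"
proof -
  have q: "q \<in> cdom c" using assms W by blast
  have "cofactor_row k (metric_matrix A g c q) \<noteq> 0"
    using diag[OF assms(2)] by (metis zero_index)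
  then obtain f where f: "components A c q v = f *\<^sub>R cofactor_row k (metric_matrix A g c q)"
    using kernel_cofactor_row assms singular_set_in_chart[OF c q] rad_in_chart[OF c q] by metis
  then have "components A c q v = components A c q (f *\<^sub>R radical_frame c k q)"
    by (simp add: linear_scale[OF linear_components[OF c q]] components_radical_frame[OF q])
  then have "v = f *\<^sub>R radical_frame c k q" using from_components[OF c q] by metis
  then show thesis using that by blast
qed

text \<open>The function \<^term>\<open>\<lambda>q. g q (E q) (E q)\<close> for the frame \<^term>\<open>E\<close> is the determinant times a
  nonvanishing cofactor, because the metric maps \<^term>\<open>E\<close> to a multiple of a basis covector.\<close>

lemma dir_deriv_radical_frame:
  assumes "q \<in> singular_set g" "q \<in> W"
  shows "dir_deriv A q v (\<lambda>r. g r (radical_frame c k r) (radical_frame c k r))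
    = cofactor_row k (metric_matrix A g c q) $ k * det_differential c q v"
proof -
  have q: "q \<in> cdom c" using assms W by blast
  let ?G = "\<lambda>x. metric_matrix A g c (point c x)"
  let ?e = "\<lambda>x. cofactor_row k (?G x) $ k"
  have xq: "coord c q \<in> coord c ` cdom c" using q by simp
  have "((\<lambda>x. ?e x * det (?G x)) has_derivative
      (\<lambda>v. ?e (coord c q) * frechet_derivative (\<lambda>x. det (?G x)) (at (coord c q)) v
        + frechet_derivative ?e (at (coord c q)) v * det (?G (coord c q)))) (at (coord c q))"
    by (intro has_derivative_mult smooth_on_has_derivative[OF _ xq] smooth_on_det_metric_matrix
        smooth_on_vec_nth smooth_on_cofactor_row open_coords c)
  moreover have "?e x * det (?G x) = ((\<lambda>r. g r (radical_frame c k r) (radical_frame c k r)) \<circ> point c) x"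
    if "x \<in> coord c ` cdom c" for x
    using point_in_cdom[OF c that]
    by (simp add: metric_in_chart[OF c] components_radical_frame matrix_mult_cofactor_row inner_axis)
  ultimately have "((\<lambda>r. g r (radical_frame c k r) (radical_frame c k r)) \<circ> point c has_derivative
      (\<lambda>v. ?e (coord c q) * frechet_derivative (\<lambda>x. det (?G x)) (at (coord c q)) v
        + frechet_derivative ?e (at (coord c q)) v * det (?G (coord c q)))) (at (coord c q))"
    by (rule has_derivative_transform_within_open[OF _ open_coords[OF c] xq])
  \<comment> \<open>At \<open>q\<close> the determinant vanishes, so the summand that differentiates
    the cofactor disappears.\<close>
  from dir_deriv_chart[OF c q this, of v] show ?thesis
    using assms(1) singular_set_in_chart[OF c q] by (simp add: point_coord[OF c q] det_differential_def)
qed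

text \<open>The number \<open>h\<close> for which the second fundamental form of
  \<open>f *\<^sub>R radical_frame c k q\<close> is \<open>- f\<^sup>2 * h\<close>; the divisor
  \<open>2\<close> is that of the Koszul formula. It carries a sign, and being positive expresses
  the sign convention for the normal.\<close>

definition frame_length :: "('a, 'n) vfield \<Rightarrow> 'a \<Rightarrow> real" where
  "frame_length N q = cofactor_row k (metric_matrix A g c q) $ k * det_differential c q (N q) / 2"

lemma second_ff_radical_frame:
  assumes "smooth_field_along A (singular_set g \<inter> V1) X" "open V1" "q \<in> V1"
    and "smooth_field_along A (singular_set g \<inter> W) N"
    and "q \<in> singular_set g" "q \<in> W" "X q = f *\<^sub>R radical_frame c k q"
  shows "second_ff A g N X X q = - f\<^sup>2 * frame_length N q"
  using second_ff_radical[OF assms(1-4) W(1) assms(6,5) W(1) assms(6) smooth_radical_frame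
      radical_frame_in_rad[OF assms(5,6)] assms(7)]
  by (simp add: dir_deriv_radical_frame[OF assms(5,6)] frame_length_def)

lemma smooth_on_frame_length:
  assumes "open U" "smooth_field A U N"
  shows "smooth_on (coord c ` (cdom c \<inter> U)) (\<lambda>x. frame_length N (point c x))"
proof (rule smooth_on_cong)
  let ?S = "coord c ` (cdom c \<inter> U)"
  let ?G = "\<lambda>x. metric_matrix A g c (point c x)"
  show S: "open ?S" by (rule open_coord_image[OF c assms(1)])
  have sub: "?S \<subseteq> coord c ` cdom c" by auto
  show "smooth_on ?S (\<lambda>x. cofactor_row k (?G x) $ k *
      (frechet_derivative (\<lambda>x. det (?G x)) (at x) (field_rep A c N x) * (1 / 2)))"
    using assms(2) c unfolding smooth_field_def
    by (intro smooth_on_mult smooth_on_const smooth_on_frechet_derivative_apply smooth_on_vec_nth S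
        smooth_on_subset[OF smooth_on_cofactor_row[OF c] sub]
        smooth_on_subset[OF smooth_on_det_metric_matrix[OF c] sub]) auto
  show "cofactor_row k (?G x) $ k * (frechet_derivative (\<lambda>x. det (?G x)) (at x) (field_rep A c N x) * (1 / 2))
      = frame_length N (point c x)" if "x \<in> ?S" for x
    using that by (auto simp: frame_length_def det_differential_def field_rep_def point_coord[OF c])
qed

text \<open>A normal is given along the hypersurface only. \<open>frame_length\<close> uses just its
  value at the point, so that of a smooth extension can stand in for it.\<close>

lemma frame_length_extension:
  assumes "smooth_field_along A (singular_set g \<inter> W) N" "q \<in> singular_set g \<inter> W"
  obtains U N' where "open U" "q \<in> U" "smooth_field A U N'"
    "\<And>r. r \<in> U \<inter> (singular_set g \<inter> W) \<Longrightarrow> frame_length N' r = frame_length N r"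
proof -
  obtain U N' where U: "open U" "q \<in> U" "smooth_field A U N'" "\<forall>r\<in>U \<inter> (singular_set g \<inter> W). N' r = N r"
    using assms unfolding smooth_field_along_def by blast
  then show thesis using that[of U N'] by (simp add: frame_length_def)
qed

lemma continuous_on_frame_length:
  assumes "smooth_field_along A (singular_set g \<inter> W) N"
  shows "continuous_on (singular_set g \<inter> W) (frame_length N)"
  unfolding continuous_on_eq_continuous_within
proof
  fix q assume q: "q \<in> singular_set g \<inter> W"
  then obtain U N' where U: "open U" "q \<in> U" "smooth_field A U N'"
    and eq: "\<And>r. r \<in> U \<inter> (singular_set g \<inter> W) \<Longrightarrow> frame_length N' r = frame_length N r"
    by (rule frame_length_extension[OF assms]) (rule that)
  have "continuous_on (cdom c \<inter> U) (coord c)"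
    using homeomorphism_cont1[OF homeomorphism_coord[OF c]] continuous_on_subset by blast
  then have "continuous_on (cdom c \<inter> U) (\<lambda>r. frame_length N' (point c (coord c r)))"
    by (rule continuous_on_compose2[OF smooth_on_imp_continuous_on[OF smooth_on_frame_length[OF U(1,3)]]]) auto
  then have cont: "continuous_on (cdom c \<inter> U) (frame_length N')"
    by (rule continuous_on_eq) (simp add: point_coord[OF c])
  have "open (cdom c \<inter> U)" "q \<in> cdom c \<inter> U" using U q W open_cdom[OF c] by auto
  then have "continuous (at q) (frame_length N')"
    using cont continuous_on_eq_continuous_at by blast
  then have "continuous (at q within singular_set g \<inter> W) (frame_length N')"
    by (rule continuous_at_imp_continuous_within)
  moreover have "frame_length N' q = frame_length N q" using U q by (intro eq) simp
  ultimately have "(frame_length N' \<longlongrightarrow> frame_length N q) (at q within singular_set g \<inter> W)"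
    by (simp add: continuous_within)
  moreover have "eventually (\<lambda>r. frame_length N' r = frame_length N r) (at q within singular_set g \<inter> W)"
    unfolding eventually_at_topological using U(1,2) eq by (intro exI[of _ U]) auto
  ultimately show "continuous (at q within singular_set g \<inter> W) (frame_length N)"
    unfolding continuous_within by (rule Lim_transform_eventually)
qed

lemma frame_length_nonzero:
  assumes "main_normal A g W N" "q \<in> singular_set g \<inter> W"
  shows "frame_length N q \<noteq> 0"
  using normal_det_differential_nonzero[OF assms(1) c, of q] diag[of q] assms(2) W(2)
  by (auto simp: frame_length_def)

lemma frame_length_minus:
  "q \<in> W \<Longrightarrow> frame_length (\<lambda>q. - N q) q = - frame_length N q"
  using linear_neg[OF linear_det_differential[OF c]] W(2) by (auto simp: frame_length_def)

text \<open>The positive solution of \<open>f\<^sup>2 * frame_length N q = 1\<close> as coefficient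
  of the frame.\<close>

definition normalized_frame :: "('a, 'n) vfield \<Rightarrow> ('a, 'n) vfield" where
  "normalized_frame N q = inverse (sqrt (frame_length N q)) *\<^sub>R radical_frame c k q"

lemma smooth_normalized_frame:
  assumes "smooth_field_along A (singular_set g \<inter> W) N"
    and pos: "\<And>q. q \<in> singular_set g \<inter> W \<Longrightarrow> frame_length N q > 0"
  shows "smooth_field_along A (singular_set g \<inter> W) (normalized_frame N)"
  unfolding smooth_field_along_def
proof
  fix q assume q: "q \<in> singular_set g \<inter> W"
  then obtain U N' where U: "open U" "q \<in> U" "smooth_field A U N'"
    and eq: "\<And>r. r \<in> U \<inter> (singular_set g \<inter> W) \<Longrightarrow> frame_length N' r = frame_length N r"
    by (rule frame_length_extension[OF assms(1)]) (rule that)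
  let ?S = "coord c ` (cdom c \<inter> U)"
  let ?h = "\<lambda>x. frame_length N' (point c x)"
  let ?e = "\<lambda>x. inverse (sqrt (?h x)) *\<^sub>R cofactor_row k (metric_matrix A g c (point c x))"
  \<comment> \<open>Off the hypersurface the extended \<open>frame_length\<close> may fail to be
    positive, so the domain is cut down to where root and inverse are smooth.\<close>
  define T where "T = ?S \<inter> ?h -` {0<..}"
  have S: "open ?S" by (rule open_coord_image[OF c U(1)])
  have sub: "T \<subseteq> coord c ` cdom c" by (auto simp: T_def)
  have smh: "smooth_on ?S ?h" by (rule smooth_on_frame_length[OF U(1,3)])
  have T: "open T"
    unfolding T_def by (rule continuous_open_preimage[OF smooth_on_imp_continuous_on[OF smh] S open_greaterThan])
  have qT: "coord c q \<in> T"
    using q U W(2) eq[of q] pos[OF q] by (auto simp: T_def point_coord[OF c])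
  let ?U = "point c ` T"
  have oU: "open ?U" by (rule open_point_image[OF c T sub])
  have UU: "?U \<subseteq> cdom c \<inter> U" using point_coord[OF c] by (auto simp: T_def)
  have img: "coord c ` ?U = T"
    using coord_point[OF c] sub by (force simp: image_image)
  have "smooth_on T ?e"
    by (intro smooth_on_scaleR smooth_on_inverse smooth_on_sqrt T smooth_on_subset[OF smh]
        smooth_on_subset[OF smooth_on_cofactor_row[OF c] sub]) (auto simp: T_def)
  then have "smooth_field A ?U (field_from c ?e)"
    using UU by (intro smooth_field_from[OF c oU]) (auto simp: img)
  moreover have "q \<in> ?U"
    using qT q W(2) by (intro image_eqI[of _ _ "coord c q"]) (auto simp: point_coord[OF c])
  moreover have "field_from c ?e r = normalized_frame N r" if "r \<in> ?U \<inter> (singular_set g \<inter> W)" for r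
  proof -
    have r: "r \<in> cdom c" "r \<in> U \<inter> (singular_set g \<inter> W)" using that UU by auto
    have "linear (coord_change c (chart_at A r) r)"
      by (rule linear_coord_change[OF c chart_at(1) r(1) chart_at(2)])
    then show ?thesis
      using eq[OF r(2)]
      by (simp add: field_from_def normalized_frame_def radical_frame_def point_coord[OF c r(1)] linear_scale)
  qed
  ultimately show "\<exists>U X'. open U \<and> q \<in> U \<and> smooth_field A U X' \<and>
      (\<forall>r\<in>U \<inter> (singular_set g \<inter> W). X' r = normalized_frame N r)"
    using oU by (intro exI[of _ ?U] exI[of _ "field_from c ?e"]) auto
qed

lemma normalized_frame_in_rad:
  "q \<in> singular_set g \<inter> W \<Longrightarrow> normalized_frame N q \<in> rad g q"
  using radical_frame_in_rad[of q] bilinear_lmul[OF bilinear_metric]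
  by (simp add: normalized_frame_def rad_def)

text \<open>Tangency is inherited from the radical, which is tangent by assumption; the value
  \<open>-1\<close> is the choice of the coefficient.\<close>

lemma unitary_normalized_frame:
  assumes "tangent_radical A g" "smooth_field_along A (singular_set g \<inter> W) N"
    and pos: "\<And>q. q \<in> singular_set g \<inter> W \<Longrightarrow> frame_length N q > 0"
  shows "unitary_radical_field A g W N (normalized_frame N)"
proof -
  note sm = smooth_normalized_frame[OF assms(2) pos]
  have "second_ff A g N (normalized_frame N) (normalized_frame N) q = -1" if q: "q \<in> singular_set g \<inter> W" for q
    using second_ff_radical_frame[OF sm W(1) _ assms(2), of q "inverse (sqrt (frame_length N q))"] q pos[OF q]
    by (simp add: normalized_frame_def power_inverse)
  then show ?thesis
    using sm normalized_frame_in_rad[of _ N] assms(1)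
    unfolding unitary_radical_field_def tangent_field_def radical_field_def tangent_radical_def by auto
qed

lemma negative_on_radical_if_frame_length_pos:
  assumes "smooth_field_along A (singular_set g \<inter> W) N"
    and pos: "\<And>q. q \<in> singular_set g \<inter> W \<Longrightarrow> frame_length N q > 0"
  shows "negative_on_radical A g W N"
proof -
  have "second_ff A g N X X q < 0"
    if V': "open V'" "V' \<subseteq> W" "radical_field A g V' X" and q: "q \<in> singular_set g \<inter> V'" "X q \<noteq> 0" for V' X q
  proof -
    have qW: "q \<in> singular_set g" "q \<in> V'" "q \<in> W" using q V' by auto
    have X: "smooth_field_along A (singular_set g \<inter> V') X" "X q \<in> rad g q"
      using V' q by (auto simp: radical_field_def)
    obtain f where f: "X q = f *\<^sub>R radical_frame c k q"
      using rad_eq_span_radical_frame[OF qW(1,3) X(2)] by blast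
    have "second_ff A g N X X q = - f\<^sup>2 * frame_length N q"
      by (rule second_ff_radical_frame[OF X(1) V'(1) qW(2) assms(1) qW(1,3) f])
    moreover have "f\<^sup>2 > 0" using f q(2) by auto
    ultimately show ?thesis using pos[of q] qW by simp
  qed
  then show ?thesis unfolding negative_on_radical_def by blast
qed

text \<open>Passing from \<open>N\<close> to \<open>N''\<close> multiplies
  \<open>frame_length\<close> by some \<open>a\<close> with \<open>a\<^sup>2 = 1\<close>. A unitary
  field for \<open>N''\<close> requires \<open>f\<^sup>2 * (a * frame_length N q) = 1\<close>, so
  positivity forces \<open>a = 1\<close>, and \<open>f\<close> is determined up to sign.\<close>

lemma unitary_radical_field_pointwise_unique:
  assumes "main_normal A g W N" and pos: "\<And>q. q \<in> singular_set g \<inter> W \<Longrightarrow> frame_length N q > 0"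
    and "main_normal A g W N''" "unitary_radical_field A g W N'' R'"
    and q: "q \<in> singular_set g \<inter> W"
  obtains s where "s = 1 \<or> s = -1" "R' q = s *\<^sub>R normalized_frame N q"
proof -
  have qW: "q \<in> singular_set g" "q \<in> W" "q \<in> cdom c" using q W by auto
  have R': "smooth_field_along A (singular_set g \<inter> W) R'" "R' q \<in> rad g q" "second_ff A g N'' R' R' q = -1"
    using assms(4) q unfolding unitary_radical_field_def radical_field_def by auto
  obtain f where f: "R' q = f *\<^sub>R radical_frame c k q"
    using rad_eq_span_radical_frame[OF qW(1,2) R'(2)] by blast
  obtain a where a: "a\<^sup>2 = (1::real)" "det_differential c q (N'' q) = a * det_differential c q (N q)"
    using normal_det_differential_unique[OF assms(1,3) c qW(3,1,2)] by blast
  have "smooth_field_along A (singular_set g \<inter> W) N''" using assms(3) by (simp add: main_normal_def)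
  from second_ff_radical_frame[OF R'(1) W(1) qW(2) this qW(1,2) f] R'(3)
  have 1: "f\<^sup>2 * (a * frame_length N q) = 1"
    by (simp add: frame_length_def a(2) mult_ac)
  have h: "frame_length N q > 0" by (rule pos[OF q])
  have "a = 1 \<or> a = -1" using a(1) by (simp add: power2_eq_1_iff)
  moreover have "a \<noteq> -1"
  proof
    assume "a = -1"
    then have "f\<^sup>2 * frame_length N q = -1" using 1 by simp
    moreover have "f\<^sup>2 * frame_length N q \<ge> 0" using h by simp
    ultimately show False by linarith
  qed
  ultimately have "f\<^sup>2 * frame_length N q = 1" using 1 by simp
  then have "(f * sqrt (frame_length N q))\<^sup>2 = 1"
    using h by (simp add: power_mult_distrib)
  then have "f * sqrt (frame_length N q) = 1 \<or> f * sqrt (frame_length N q) = -1"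
    by (simp add: power2_eq_1_iff)
  moreover have "R' q = (f * sqrt (frame_length N q)) *\<^sub>R normalized_frame N q"
    using h by (simp add: f normalized_frame_def)
  ultimately show thesis using that by blast
qed

lemma unitary_radical_field_unique:
  assumes "connected (singular_set g \<inter> W)"
    and N: "main_normal A g W N" and pos: "\<And>q. q \<in> singular_set g \<inter> W \<Longrightarrow> frame_length N q > 0"
    and "main_normal A g W N''" "unitary_radical_field A g W N'' R'"
  shows "(\<forall>q\<in>singular_set g \<inter> W. R' q = normalized_frame N q) \<or>
    (\<forall>q\<in>singular_set g \<inter> W. R' q = - normalized_frame N q)"
proof -
  let ?S = "singular_set g \<inter> W" and ?R = "normalized_frame N"
  have smN: "smooth_field_along A ?S N" using N by (simp add: main_normal_def)
  have smR': "smooth_field_along A ?S R'"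
    using assms(5) by (simp add: unitary_radical_field_def radical_field_def)
  \<comment> \<open>The quotient recovers the pointwise sign. Its denominator is a positive multiple
    of the diagonal cofactor, and components in \<open>c\<close> make it continuous.\<close>
  define s where "s = (\<lambda>q. components A c q (R' q) $ k / components A c q (?R q) $ k)"
  have nz: "components A c q (?R q) $ k \<noteq> 0" if "q \<in> ?S" for q
  proof -
    have q: "q \<in> cdom c" using that W by auto
    show ?thesis
      using pos[OF that] diag[of q] that
      by (simp add: normalized_frame_def linear_scale[OF linear_components[OF c q]] components_radical_frame[OF q])
  qed
  have s: "s q = 1 \<and> R' q = ?R q \<or> s q = -1 \<and> R' q = - ?R q" if q: "q \<in> ?S" for q
  proof -
    obtain t where t: "t = 1 \<or> t = -1" "R' q = t *\<^sub>R ?R q"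
      using unitary_radical_field_pointwise_unique[OF N pos assms(4,5) q] by blast
    have "q \<in> cdom c" using q W by auto
    then have "s q = t"
      using nz[OF q] by (simp add: s_def t(2) linear_scale[OF linear_components[OF c]])
    then show ?thesis using t by auto
  qed
  have "?S \<subseteq> cdom c" using W by auto
  then have "continuous_on ?S s"
    unfolding s_def using nz
    by (intro continuous_on_divide continuous_on_component continuous_on_components[OF _ c]
        smR' smooth_normalized_frame[OF smN pos]) auto
  then have "(\<forall>q\<in>?S. s q > 0) \<or> (\<forall>q\<in>?S. s q < 0)"
    by (rule connected_nonzero_sign[OF assms(1)]) (use s in fastforce)
  then show ?thesis
  proof
    assume *: "\<forall>q\<in>?S. s q > 0"
    have "R' q = ?R q" if "q \<in> ?S" for q using s[OF that] bspec[OF * that] by auto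
    then show ?thesis by blast
  next
    assume *: "\<forall>q\<in>?S. s q < 0"
    have "R' q = - ?R q" if "q \<in> ?S" for q using s[OF that] bspec[OF * that] by auto
    then show ?thesis by blast
  qed
qed

end

text \<open>Shrinking a neighbourhood can disconnect the piece of the hypersurface in it, so the
  conditions on the cofactor and on \<open>V\<close> are built into the open set \<open>Q\<close> in
  which the connected piece is found.\<close>

lemma radical_frame_neighbourhood:
  assumes "p \<in> singular_set g" "open V" "p \<in> V"
  obtains c k W where "c \<in> A" "open W" "W \<subseteq> cdom c" "p \<in> W" "W \<subseteq> V" "connected (singular_set g \<inter> W)"
    "\<And>q. q \<in> W \<Longrightarrow> cofactor_row k (metric_matrix A g c q) $ k \<noteq> 0"
proof -
  define c where "c = chart_at A p"
  have c: "c \<in> A" "p \<in> cdom c" using chart_at c_def by auto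
  let ?G = "\<lambda>x. metric_matrix A g c (point c x)"
  let ?C = "coord c ` cdom c"
  have xC: "coord c p \<in> ?C" using c by simp
  have det0: "det (?G (coord c p)) = 0"
    using assms(1) singular_set_in_chart[OF c] by (simp add: point_coord[OF c])
  obtain l where "cofactor_row l (?G (coord c p)) \<noteq> 0"
    by (rule cofactor_row_nonzero_if_det_derivative_nonzero[OF open_coords[OF c(1)] xC
        smooth_on_metric_matrix[OF c(1)] det0 transverse[OF c(1) assms(1) c(2)]])
  then obtain k where k: "cofactor_row k (?G (coord c p)) $ k \<noteq> 0"
    using symmetric_cofactor_diagonal[OF metric_matrix_symmetric det0] by blast
  define Q where "Q = coord c ` (cdom c \<inter> V) \<inter> (\<lambda>x. cofactor_row k (?G x) $ k) -` (- {0})"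
  have "smooth_on (coord c ` (cdom c \<inter> V)) (\<lambda>x. cofactor_row k (?G x) $ k)"
    by (intro smooth_on_vec_nth open_coord_image c assms smooth_on_subset[OF smooth_on_cofactor_row[OF c(1)]]) auto
  from continuous_open_preimage[OF smooth_on_imp_continuous_on[OF this] open_coord_image[OF c(1) assms(2)], of "-{0}"]
  have "open Q" by (simp add: Q_def open_Compl)
  have "coord c p \<in> Q" using c assms(3) k by (auto simp: Q_def)
  have QC: "Q \<subseteq> ?C" by (auto simp: Q_def)
  obtain W0 where W0: "open W0" "coord c p \<in> W0" "W0 \<subseteq> Q" "connected {y \<in> W0. det (?G y) = 0}"
    by (rule zero_set_locally_connected[OF \<open>open Q\<close> smooth_on_subset[OF smooth_on_det_metric_matrix[OF c(1)] QC]
        \<open>coord c p \<in> Q\<close> det0 transverse[OF c(1) assms(1) c(2)]])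
  have WC: "W0 \<subseteq> ?C" using W0 QC by blast
  let ?W = "point c ` W0"
  have Wd: "?W \<subseteq> cdom c" using point_in_cdom[OF c(1)] WC by blast
  have "singular_set g \<inter> ?W = point c ` {y \<in> W0. det (?G y) = 0}"
    using singular_set_in_chart[OF c(1)] Wd by auto
  moreover have "continuous_on {y \<in> W0. det (?G y) = 0} (point c)"
    using homeomorphism_cont2[OF homeomorphism_coord[OF c(1)]] by (rule continuous_on_subset) (use WC in auto)
  ultimately have "connected (singular_set g \<inter> ?W)"
    using connected_continuous_image[OF _ W0(4)] by (simp only:)
  moreover have "open ?W" by (rule open_point_image[OF c(1) W0(1) WC])
  moreover have "p \<in> ?W" using W0(2) c by (intro image_eqI[of _ _ "coord c p"]) (auto simp: point_coord)
  moreover have "?W \<subseteq> V"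
    using W0(3) point_coord[OF c(1)] by (auto simp: Q_def)
  moreover have "cofactor_row k (metric_matrix A g c q) $ k \<noteq> 0" if "q \<in> ?W" for q
    using that W0(3) by (auto simp: Q_def)
  ultimately show thesis using that[of c ?W k] c(1) Wd by blast
qed

end

text \<open>The neighbourhood \<open>W\<close> has to meet the hypersurface in a connected set: on a
  disconnected piece \<open>R\<close> could change sign on each component separately.\<close>

theorem proposition2:
  fixes A :: "('a::{t2_space,second_countable_topology}, 'n::finite) chart set"
    and g :: "('a, 'n) tensor2"
    and p :: 'a and V :: "'a set" and N :: "('a, 'n) vfield"
  assumes "transverse_singular_space A g"
    and "tangent_radical A g"
    and "p \<in> singular_set g"
    and "open V" and "p \<in> V" and "main_normal A g V N"
  shows "\<exists>W N'. open W \<and> p \<in> W \<and> W \<subseteq> V \<and>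
           (N' = N \<or> N' = (\<lambda>q. - N q)) \<and> main_normal A g W N' \<and> negative_on_radical A g W N' \<and>
           (\<exists>R. unitary_radical_field A g W N' R \<and>
              (\<forall>N'' R'. main_normal A g W N'' \<and> unitary_radical_field A g W N'' R' \<longrightarrow>
                 (\<forall>q\<in>singular_set g \<inter> W. R' q = R q) \<or>
                 (\<forall>q\<in>singular_set g \<inter> W. R' q = - R q)))"
proof -
  interpret transverse_metric A g
    using assms(1) unfolding transverse_singular_space_def by unfold_locales auto
  obtain c k W where c: "c \<in> A" and W: "open W" "W \<subseteq> cdom c" "p \<in> W" "W \<subseteq> V"
    and conn: "connected (singular_set g \<inter> W)"
    and diag: "\<And>q. q \<in> W \<Longrightarrow> cofactor_row k (metric_matrix A g c q) $ k \<noteq> 0"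
    by (rule radical_frame_neighbourhood[OF assms(3-5)]) (rule that)
  note frame = c W(1,2) diag
  have N: "main_normal A g W N" by (rule main_normal_subset[OF assms(6) W(4)])
  \<comment> \<open>Continuous and nonvanishing on a connected set, \<open>frame_length\<close> has
    constant sign; being odd in the normal, it becomes positive by one choice between
    \<open>N\<close> and its negative.\<close>
  have "(\<forall>q\<in>singular_set g \<inter> W. frame_length c k N q > 0) \<or> (\<forall>q\<in>singular_set g \<inter> W. frame_length c k N q < 0)"
    using continuous_on_frame_length[OF frame] frame_length_nonzero[OF frame N] N
    by (intro connected_nonzero_sign[OF conn]) (auto simp: main_normal_def)
  then obtain N' where N': "N' = N \<or> N' = (\<lambda>q. - N q)"
    and pos: "\<And>q. q \<in> singular_set g \<inter> W \<Longrightarrow> frame_length c k N' q > 0"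
    using frame_length_minus[OF frame, of _ N] by (metis IntD2 neg_0_less_iff_less)
  have main: "main_normal A g W N'" using N' N main_normal_minus[OF N W(1)] by blast
  then have sm: "smooth_field_along A (singular_set g \<inter> W) N'" by (simp add: main_normal_def)
  show ?thesis
  proof (rule exI[of _ W], rule exI[of _ N'], intro conjI exI[of _ "normalized_frame c k N'"] allI impI)
    show "negative_on_radical A g W N'"
      by (rule negative_on_radical_if_frame_length_pos[OF frame sm pos])
    show "unitary_radical_field A g W N' (normalized_frame c k N')"
      by (rule unitary_normalized_frame[OF frame assms(2) sm pos])
    show "(\<forall>q\<in>singular_set g \<inter> W. R' q = normalized_frame c k N' q) \<or>
        (\<forall>q\<in>singular_set g \<inter> W. R' q = - normalized_frame c k N' q)"
      if "main_normal A g W N'' \<and> unitary_radical_field A g W N'' R'" for N'' R'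
      using unitary_radical_field_unique[OF frame conn main pos] that by blast
  qed (use W N' main in auto)
qed

end
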